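(* Let $V$ be a real separable Hilbert space and let $a,b,m$ be symmetric bilinear forms on $V$ such that $a$ is continuous and $V$-coercive, $b$ is weakly continuous, and $m$ is weakly continuous with $m(u,u)>0$ for all nonzero $u\in V$. Let $\mu_*\in\mathbb{R}$ with $\mu_*\notin\sigma(a,m)$ be fixed, and for each $i$ let $K_i(\mu_* )$ be the number of components of the superlevel set $\{\mu_i>\mu_*\}$. Then for each $n\in\mathbb{N}$, $$\sum_{i=1}^nK_i(\mu_* )\le n.$$
   Context: "$a$ is continuous and $V$-coercive" means there are constants $0<\kappa_1\le\kappa_2<\infty$ with $\kappa_1\|u\|^2\le a(u,u)\le\kappa_2\|u\|^2$ for all $u\in V$. A symmetric bilinear form $b$ on $V$ is weakly continuous if $u_j\rightharpoonup u$ and $v_j\rightharpoonup v$ weakly in $V$ imply $b(u_j,v_j)\to b(u,v)$. $\sigma(a,m)$ is the set of $\mu\in\mathbb{R}$ for which there is a nonzero $u\in V$ with $a(u,v)=\mu\,m(u,v)$ for all $v\in V$. For $\lambda\in\mathbb{R}$ and $n\in\mathbb{N}$ (with $n\le\dim V$ if $V$ is finite dimensional), $\mu_n(\lambda)$ is the $n$-th smallest, counted with multiplicity, of the real numbers $\mu$ for which there is a nonzero $u\in V$ with $a(u,v)-\lambda b(u,v)=\mu\,m(u,v)$ for all $v\in V$; equivalently $\mu_n(\lambda)=\inf_{Z_n}\sup_{0\ne v\in Z_n}\frac{a(v,v)-\lambda b(v,v)}{m(v,v)}$ over $n$-dimensional subspaces $Z_n$ of $V$. $\{\mu_n>\mu_*\}:=\{\lambda\in\mathbb{R}:\mu_n(\lambda)>\mu_*\}$.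 A component of $\{\mu_n>\mu_*\}$ is an interval of one of the following forms: a finite interval $(s,t)$ with $\mu_n(s)=\mu_n(t)=\mu_*$ and $\mu_n>\mu_*$ on $(s,t)$; a semi-infinite interval $(s,\infty)$ with $\mu_n(s)=\mu_*$ and $\mu_n>\mu_*$ on $(s,\infty)$; or a semi-infinite interval $(-\infty,t)$ with $\mu_n(t)=\mu_*$ and $\mu_n>\mu_*$ on $(-\infty,t)$. (The whole line $\mathbb{R}$ does not count as a component.) *)

theory Defs
  imports "HOL-Analysis.Analysis" "HOL-Library.Extended_Nat"
begin

definition symmetric_bilinear :: "('a::real_vector \<Rightarrow> 'a \<Rightarrow> real) \<Rightarrow> bool" where
  "symmetric_bilinear f \<longleftrightarrow> bilinear f \<and> (\<forall>u v. f u v = f v u)"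

definition continuous_coercive :: "('a::real_normed_vector \<Rightarrow> 'a \<Rightarrow> real) \<Rightarrow> bool" where
  "continuous_coercive a \<longleftrightarrow>
     (\<exists>\<kappa>1 \<kappa>2. 0 < \<kappa>1 \<and> \<kappa>1 \<le> \<kappa>2 \<and>
        (\<forall>u. \<kappa>1 * (norm u)\<^sup>2 \<le> a u u \<and> a u u \<le> \<kappa>2 * (norm u)\<^sup>2))"

definition weakly_converges :: "(nat \<Rightarrow> 'a::real_normed_vector) \<Rightarrow> 'a \<Rightarrow> bool" where
  "weakly_converges x l \<longleftrightarrow>
     (\<forall>f :: 'a \<Rightarrow> real. bounded_linear f \<longrightarrow> (\<lambda>j. f (x j)) \<longlonglongrightarrow> f l)"

definition weakly_continuous :: "('a::real_normed_vector \<Rightarrow> 'a \<Rightarrow> real) \<Rightarrow> bool" where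
  "weakly_continuous b \<longleftrightarrow>
     (\<forall>x y u v. weakly_converges x u \<longrightarrow> weakly_converges y v \<longrightarrow>
        (\<lambda>j. b (x j) (y j)) \<longlonglongrightarrow> b u v)"

definition form_eigenspace ::
  "('a::real_vector \<Rightarrow> 'a \<Rightarrow> real) \<Rightarrow> ('a \<Rightarrow> 'a \<Rightarrow> real) \<Rightarrow> real \<Rightarrow> 'a set" where
  "form_eigenspace c m \<mu> = {u. \<forall>v. c u v = \<mu> * m u v}"

definition form_spectrum ::
  "('a::real_vector \<Rightarrow> 'a \<Rightarrow> real) \<Rightarrow> ('a \<Rightarrow> 'a \<Rightarrow> real) \<Rightarrow> real set" where
  "form_spectrum c m = {\<mu>. \<exists>u. u \<noteq> 0 \<and> (\<forall>v. c u v = \<mu> * m u v)}"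

text \<open>
  The \<open>n\<close>-th smallest eigenvalue (\<open>n \<ge> 1\<close>), counted with multiplicity: the least eigenvalue
  \<open>\<mu>\<close> such that at least \<open>n\<close> eigenvalues, counted with multiplicity, are \<open>\<le> \<mu>\<close>. The
  conventions that \<open>sum\<close> over an infinite set and \<open>dim\<close> of an infinite-dimensional space
  are 0 play no role for \<open>c = a - t b\<close> with \<open>a\<close> continuous and coercive, \<open>b\<close> and \<open>m\<close> weakly
  continuous and \<open>m\<close> positive: all eigenspaces are then finite-dimensional and only finitely
  many eigenvalues lie below any given bound.
\<close>
definition nth_eigenvalue ::
  "('a::real_vector \<Rightarrow> 'a \<Rightarrow> real) \<Rightarrow> ('a \<Rightarrow> 'a \<Rightarrow> real) \<Rightarrow> nat \<Rightarrow> real" where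
  "nth_eigenvalue c m n =
     (LEAST \<mu>. \<mu> \<in> form_spectrum c m \<and>
        n \<le> (\<Sum>\<nu>\<in>{\<nu> \<in> form_spectrum c m. \<nu> \<le> \<mu>}. dim (form_eigenspace c m \<nu>)))"

definition pencil_eigenvalue ::
  "('a::real_vector \<Rightarrow> 'a \<Rightarrow> real) \<Rightarrow> ('a \<Rightarrow> 'a \<Rightarrow> real) \<Rightarrow> ('a \<Rightarrow> 'a \<Rightarrow> real) \<Rightarrow>
     nat \<Rightarrow> real \<Rightarrow> real" where
  "pencil_eigenvalue a b m n t = nth_eigenvalue (\<lambda>u v. a u v - t * b u v) m n"

text \<open>
  Components of \<open>{f > c}\<close>. The whole line is deliberately not a component, and \<open>s < t\<close> keeps
  the empty interval from being one.
\<close>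
definition superlevel_components :: "(real \<Rightarrow> real) \<Rightarrow> real \<Rightarrow> real set set" where
  "superlevel_components f c =
     {{s<..<t} | s t. s < t \<and> f s = c \<and> f t = c \<and> (\<forall>x\<in>{s<..<t}. c < f x)} \<union>
     {{s<..} | s. f s = c \<and> (\<forall>x\<in>{s<..}. c < f x)} \<union>
     {{..<t} | t. f t = c \<and> (\<forall>x\<in>{..<t}. c < f x)}"

definition num_superlevel_components :: "(real \<Rightarrow> real) \<Rightarrow> real \<Rightarrow> enat" where
  "num_superlevel_components f c =
     (if finite (superlevel_components f c)
      then enat (card (superlevel_components f c)) else \<infinity>)"

end

theory Submission imports Defs begin

text \<open>
  Write \<open>q t = a - t b - \<mu>\<^sub>s m\<close>. By the min-max principle (\<open>nth_eigenvalue_le_iff\<close>) the \<open>i\<close>-th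
  eigenvalue at \<open>t\<close> is at most \<open>\<mu>\<^sub>s\<close> exactly if \<open>q t\<close> is nonpositive on some \<open>i\<close>-dimensional subspace.
  So, with \<open>f t\<close> the largest dimension of a nonpositive subspace of \<open>q t\<close>, the \<open>i\<close>-th superlevel set
  is \<open>{t. f t < i}\<close>, and the theorem becomes a statement about how often the integer function \<open>f\<close>
  can fall below the levels \<open>1, \<dots>, n\<close>.

  Suppose there is a component at all and let \<open>l\<close> be a point of one of them, so that \<open>f l < n\<close>. At
  each level there is at most one component containing \<open>l\<close>, and only at levels above \<open>f l\<close>; this
  makes at most \<open>n - f l\<close>. Every other component, at level \<open>i\<close> say, is entered on the way from \<open>l\<close> by
  crossing its near end, where \<open>f\<close> falls from at least \<open>i\<close> to below \<open>i\<close>. Hence it suffices that the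
  total of all falls of \<open>f\<close>, going away from \<open>l\<close> in both directions, is at most \<open>f l\<close>.

  This bound (\<open>sum_index_drops_le\<close>) is algebraic. If \<open>u\<close> is an eigenvector, \<open>q \<sigma> u = 0\<close>, then
  \<open>q t u = (\<sigma> - t) b u\<close>, and a fall at \<open>\<sigma>\<close> caused by \<open>u\<close>, away from \<open>l\<close>, means \<open>q l u u < 0\<close>. As
  eigenvectors for different \<open>\<sigma>\<close> are orthogonal for \<open>q l\<close>, each fall uses up a negative direction of
  \<open>q l\<close>. Isotropic eigenvectors, which occur at multiple roots, are treated by passing to \<open>u\<close>-orthogonal
  vectors modulo \<open>u\<close>, which removes one negative and one positive direction for every \<open>t\<close> at once.
  The bound is needed for finitely many values of \<open>t\<close> only, so it may be proved on a
  finite-dimensional subspace, after a small change of \<open>\<mu>\<^sub>s\<close> that makes the form nondegenerate at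
  these values (\<open>card_components_le\<close>).

  The analytic part is the min-max principle. Coercivity of \<open>a\<close> and weak continuity of \<open>b\<close> and \<open>m\<close>
  exclude weakly null unit sequences with Rayleigh quotients bounded above. Orthonormal sequences are weakly
  null by Bessel's inequality, and minimizing sequences without a minimizer are weakly null by an
  argument with nested convex sets; so spans of low eigenvectors are finite dimensional and Rayleigh
  quotients attain their infima.
\<close>

section \<open>Dimension of finite-dimensional subspaces\<close>

text \<open>
The ambient space may be infinite dimensional, where \<open>dim\<close> is monotone only below a subspace with
a finite spanning set; \<open>fin_dim\<close> carries that side condition.
\<close>

definition fin_dim :: "'a::real_vector set \<Rightarrow> bool" where
  "fin_dim S \<longleftrightarrow> (\<exists>B. finite B \<and> S \<subseteq> span B)"

lemma fin_dim_span: "finite B \<Longrightarrow> fin_dim (span B)"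
  by (auto simp: fin_dim_def)

lemma fin_dim_subset: "fin_dim S \<Longrightarrow> T \<subseteq> S \<Longrightarrow> fin_dim T"
  by (auto simp: fin_dim_def)

lemma fin_dim_span_insert: "fin_dim S \<Longrightarrow> fin_dim (span (insert x S))"
proof -
  assume "fin_dim S"
  then obtain B where B: "finite B" "S \<subseteq> span B" by (auto simp: fin_dim_def)
  have "insert x S \<subseteq> span (insert x B)"
    using B(2) span_mono[of B "insert x B"] by (auto intro: span_base)
  then have "span (insert x S) \<subseteq> span (insert x B)"
    by (simp add: span_minimal)
  with B(1) show ?thesis unfolding fin_dim_def by (meson finite_insert)
qed

lemma independent_card_le_dim_fin:
  assumes "fin_dim S" "B \<subseteq> S" "independent B"
  shows "finite B" "card B \<le> dim S"
proof -
  obtain C where C: "finite C" "S \<subseteq> span C" using assms(1) by (auto simp: fin_dim_def)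
  show "finite B" using independent_span_bound[OF C(1) assms(3)] C(2) assms(2) by auto
  obtain D where D: "D \<subseteq> S" "independent D" "S \<subseteq> span D" "card D = dim S"
    using basis_exists by blast
  have "finite D" using independent_span_bound[OF C(1) D(2)] C(2) D(1) by auto
  then show "card B \<le> dim S"
    using independent_span_bound[OF _ assms(3), of D] D assms(2) by auto
qed

lemma fin_dim_basis:
  assumes "fin_dim S" "subspace S"
  obtains B where "finite B" "B \<subseteq> S" "independent B" "span B = S" "card B = dim S"
proof -
  obtain B where B: "B \<subseteq> S" "independent B" "S \<subseteq> span B" "card B = dim S"
    using basis_exists by blast
  moreover have "span B = S" using B assms(2) by (simp add: span_minimal subset_antisym)
  ultimately show ?thesis using that independent_card_le_dim_fin[OF assms(1)] by blast
qed

lemma dim_mono_fin: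
  assumes "fin_dim S" "T \<subseteq> S"
  shows "dim T \<le> dim S"
proof -
  obtain D where D: "D \<subseteq> T" "independent D" "T \<subseteq> span D" "card D = dim T"
    using basis_exists by blast
  with independent_card_le_dim_fin(2)[OF assms(1), of D] assms(2) show ?thesis by auto
qed

lemma dim_span_insert_fin:
  assumes "fin_dim S" "subspace S" "x \<notin> S"
  shows "dim (span (insert x S)) = Suc (dim S)"
proof -
  obtain B where B: "finite B" "B \<subseteq> S" "independent B" "span B = S" "card B = dim S"
    using fin_dim_basis assms by blast
  have 1: "independent (insert x B)" using B assms(3) by (simp add: independent_insertI)
  have 2: "span (insert x B) = span (insert x S)"
    by (metis B(4) assms(2) span_eq_iff span_insert)
  have "x \<notin> B" using B assms(3) by auto
  then show ?thesis using dim_span_eq_card_independent[OF 1] 2 B by auto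
qed

lemma independent_Un_trivial_meet:
  assumes "finite A" "independent A" "independent B" "span A \<inter> span B \<subseteq> {0}"
  shows "independent (A \<union> B)"
  using assms
proof (induction A rule: finite_induct)
  case empty
  then show ?case by simp
next
  case (insert x F)
  have F: "independent F" "x \<notin> span F" using insert by (auto simp: independent_insert)
  have "span F \<inter> span B \<subseteq> {0}" using insert(6) span_mono[of F "insert x F"] by auto
  then have ind: "independent (F \<union> B)" using insert F by auto
  have "x \<notin> span (F \<union> B)"
  proof
    assume "x \<in> span (F \<union> B)"
    then obtain f p where fp: "f \<in> span F" "p \<in> span B" "x = f + p" by (auto simp: span_Un)
    have "f \<in> span (insert x F)" using fp(1) span_mono[of F "insert x F"] by auto
    then have "x - f \<in> span (insert x F)" by (simp add: span_base span_diff)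
    with fp insert(6) have "p = 0" by auto
    with fp F show False by auto
  qed
  with ind show ?case by (simp add: independent_insertI)
qed

lemma dim_add_le_of_trivial_meet:
  assumes "fin_dim S" "T \<subseteq> S" "P \<subseteq> S" "subspace T" "subspace P" "T \<inter> P \<subseteq> {0}"
  shows "dim T + dim P \<le> dim S"
proof -
  obtain A where A: "finite A" "A \<subseteq> T" "independent A" "span A = T" "card A = dim T"
    using fin_dim_basis fin_dim_subset assms by metis
  obtain B where B: "finite B" "B \<subseteq> P" "independent B" "span B = P" "card B = dim P"
    using fin_dim_basis fin_dim_subset assms by metis
  have ind: "independent (A \<union> B)"
    using independent_Un_trivial_meet A B assms by metis
  have "A \<inter> B = {}"
  proof -
    have "0 \<notin> A" using A(3) dependent_zero by blast
    moreover have "A \<inter> B \<subseteq> {0}" using A(2) B(2) assms(6) by blast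
    ultimately show ?thesis by blast
  qed
  then have "card (A \<union> B) = dim T + dim P" using A B by (simp add: card_Un_disjoint)
  with independent_card_le_dim_fin(2)[OF assms(1) _ ind] A B assms show ?thesis by auto
qed

text \<open>
The sums \<open>t + p\<close> already fill a subspace of \<open>S\<close> of full dimension; a vector outside it would
raise the dimension above that of \<open>S\<close>.
\<close>

lemma sum_of_complementary:
  assumes "fin_dim S" "subspace S" "T \<subseteq> S" "P \<subseteq> S" "subspace T" "subspace P" "T \<inter> P \<subseteq> {0}"
    and "dim S \<le> dim T + dim P" and "x \<in> S"
  obtains t p where "t \<in> T" "p \<in> P" "x = t + p"
proof -
  let ?U = "{t + p | t p. t \<in> T \<and> p \<in> P}"
  have U: "subspace ?U" using assms(5,6) by (rule subspace_sums)
  have US: "?U \<subseteq> S" using assms(2-4) by (auto intro: subspace_add)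
  have TU: "T \<subseteq> ?U" using subspace_0[OF assms(6)] by force
  have PU: "P \<subseteq> ?U" using subspace_0[OF assms(5)] by force
  have fU: "fin_dim ?U" using assms(1) US by (rule fin_dim_subset)
  have d: "dim T + dim P \<le> dim ?U"
    using dim_add_le_of_trivial_meet[OF fU TU PU assms(5-7)] .
  have "x \<in> ?U"
  proof (rule ccontr)
    assume "x \<notin> ?U"
    then have "dim (span (insert x ?U)) = Suc (dim ?U)"
      by (rule dim_span_insert_fin[OF fU U])
    moreover have "span (insert x ?U) \<subseteq> S" using US assms(2,9) by (simp add: span_minimal)
    ultimately have "Suc (dim ?U) \<le> dim S"
      using dim_mono_fin[OF assms(1), of "span (insert x ?U)"] by linarith
    with d assms(8) show False by simp
  qed
  with that show ?thesis by blast
qed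

lemma subspace_kernel_in: "subspace S \<Longrightarrow> linear f \<Longrightarrow> subspace {x \<in> S. f x = 0}"
  by (auto simp: subspace_def linear_add linear_scale linear_0)

lemma dim_le_Suc_dim_kernel:
  fixes f :: "'a::real_vector \<Rightarrow> real"
  assumes "fin_dim S" "subspace S" "linear f"
  shows "dim S \<le> Suc (dim {x \<in> S. f x = 0})"
proof (cases "\<exists>w\<in>S. f w \<noteq> 0")
  case False
  then have "{x \<in> S. f x = 0} = S" by auto
  then show ?thesis by simp
next
  case True
  then obtain w where w: "w \<in> S" "f w \<noteq> 0" by auto
  let ?K = "{x \<in> S. f x = 0}"
  have K: "subspace ?K" "fin_dim ?K"
    using subspace_kernel_in assms fin_dim_subset[of S ?K] by auto
  have "S \<subseteq> span (insert w ?K)"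
  proof
    fix x assume x: "x \<in> S"
    have "x - (f x / f w) *\<^sub>R w \<in> ?K"
      using x w assms(2,3) by (simp add: linear_diff linear_scale subspace_diff subspace_scale)
    then show "x \<in> span (insert w ?K)" by (auto simp: span_insert intro: span_base)
  qed
  then have "dim S \<le> dim (span (insert w ?K))"
    using dim_mono_fin fin_dim_span_insert[OF K(2)] by blast
  also have "\<dots> = Suc (dim ?K)" using w K by (intro dim_span_insert_fin) auto
  finally show ?thesis .
qed

text \<open>
Each linear equation costs at most one dimension.
\<close>

lemma dim_le_dim_joint_kernel:
  fixes f :: "'b \<Rightarrow> 'a::real_vector \<Rightarrow> real"
  assumes "finite I" "fin_dim S" "subspace S" "\<And>i. i \<in> I \<Longrightarrow> linear (f i)"
  shows "dim S \<le> dim {x \<in> S. \<forall>i\<in>I. f i x = 0} + card I"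
  using assms
proof (induction I rule: finite_induct)
  case empty
  then show ?case by simp
next
  case (insert i I)
  let ?K = "{x \<in> S. \<forall>i\<in>I. f i x = 0}"
  have K: "fin_dim ?K" using fin_dim_subset[OF insert(4), of ?K] by auto
  have K': "subspace ?K"
    using insert(5,6) by (auto simp: subspace_def linear_add linear_scale linear_0)
  have "dim ?K \<le> Suc (dim {x \<in> ?K. f i x = 0})"
    using dim_le_Suc_dim_kernel[OF K K'] insert(6) by blast
  moreover have "{x \<in> ?K. f i x = 0} = {x \<in> S. \<forall>j\<in>insert i I. f j x = 0}" by auto
  moreover have "dim S \<le> dim ?K + card I" using insert by auto
  ultimately show ?case using insert(1,2) by simp
qed

lemma exists_nonzero_of_dim_pos: "0 < dim S \<Longrightarrow> \<exists>x\<in>S. x \<noteq> 0"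
proof (rule ccontr)
  assume "0 < dim S" "\<not> (\<exists>x\<in>S. x \<noteq> 0)"
  then have "S \<subseteq> span {}" by auto
  from dim_le_card[OF this] \<open>0 < dim S\<close> show False by simp
qed

section \<open>Symmetric bilinear forms and their index\<close>

lemma symmetric_bilinearI:
  assumes "\<And>u. linear (f u)" "\<And>u v. f u v = f v u"
  shows "symmetric_bilinear f"
proof -
  have "(\<lambda>u. f u v) = f v" for v using assms(2) by auto
  then show ?thesis using assms by (auto simp: symmetric_bilinear_def bilinear_def)
qed

lemma
  assumes "symmetric_bilinear q"
  shows sb_linear: "linear (q u)"
    and sb_sym: "q u v = q v u"
    and sb_add_right: "q u (v + w) = q u v + q u w"
    and sb_add_left: "q (v + w) u = q v u + q w u"
    and sb_diff_right: "q u (v - w) = q u v - q u w"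
    and sb_diff_left: "q (v - w) u = q v u - q w u"
    and sb_scale_right: "q u (c *\<^sub>R v) = c * q u v"
    and sb_scale_left: "q (c *\<^sub>R v) u = c * q v u"
    and sb_zero_right: "q u 0 = 0"
    and sb_zero_left: "q 0 u = 0"
  using assms unfolding symmetric_bilinear_def
  by (auto simp: bilinear_ladd bilinear_radd bilinear_lsub bilinear_rsub bilinear_lmul
      bilinear_rmul bilinear_lzero bilinear_rzero) (auto simp: bilinear_def)

lemmas sb_simps = sb_add_right sb_add_left sb_diff_right sb_diff_left
  sb_scale_right sb_scale_left sb_zero_right sb_zero_left

lemma sb_diff_scale:
  assumes "symmetric_bilinear f" "symmetric_bilinear g"
  shows "symmetric_bilinear (\<lambda>u v. f u v - t * g u v)"
proof (rule symmetric_bilinearI)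
  show "linear (\<lambda>v. f u v - t * g u v)" for u
    by (rule linearI) (simp_all add: sb_simps[OF assms(1)] sb_simps[OF assms(2)] algebra_simps)
qed (simp add: sb_sym[OF assms(1)] sb_sym[OF assms(2)])

lemma sb_uminus: "symmetric_bilinear q \<Longrightarrow> symmetric_bilinear (\<lambda>u v. - q u v)"
  by (rule symmetric_bilinearI, rule linearI) (simp_all add: sb_simps sb_sym)

lemma sb_add_self:
  assumes "symmetric_bilinear q"
  shows "q (x + y) (x + y) = q x x + 2 * q x y + q y y"
  using sb_sym[OF assms, of x y] by (simp add: sb_simps[OF assms])

text \<open>
Otherwise \<open>q (t *\<^sub>R u + v) (t *\<^sub>R u + v) = 2 * t * q u v + q v v\<close> would be a nonconstant affine
function of \<open>t\<close>, hence negative somewhere.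
\<close>

lemma psd_zero_imp_radical:
  assumes q: "symmetric_bilinear q" and S: "subspace S"
    and psd: "\<And>x. x \<in> S \<Longrightarrow> 0 \<le> q x x" and u: "u \<in> S" "q u u = 0" and v: "v \<in> S"
  shows "q u v = 0"
proof (rule ccontr)
  assume ne: "q u v \<noteq> 0"
  define t where "t = - (q v v + 1) / (2 * q u v)"
  have "t *\<^sub>R u + v \<in> S" using S u v by (simp add: subspace_add subspace_scale)
  then have "0 \<le> q (t *\<^sub>R u + v) (t *\<^sub>R u + v)" by (rule psd)
  also have "\<dots> = 2 * t * q u v + q v v"
    using u(2) unfolding sb_add_self[OF q] by (simp add: sb_simps[OF q])
  also have "\<dots> = - 1" using ne by (simp add: t_def field_simps)
  finally show False by simp
qed

definition nondeg_on :: "('a::real_vector \<Rightarrow> 'a \<Rightarrow> real) \<Rightarrow> 'a set \<Rightarrow> bool" where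
  "nondeg_on q S \<longleftrightarrow> (\<forall>u\<in>S. (\<forall>v\<in>S. q u v = 0) \<longrightarrow> u = 0)"

definition posdef_on :: "('a::real_vector \<Rightarrow> 'a \<Rightarrow> real) \<Rightarrow> 'a set \<Rightarrow> bool" where
  "posdef_on q S \<longleftrightarrow> (\<forall>x\<in>S. x \<noteq> 0 \<longrightarrow> 0 < q x x)"

definition negdef_on :: "('a::real_vector \<Rightarrow> 'a \<Rightarrow> real) \<Rightarrow> 'a set \<Rightarrow> bool" where
  "negdef_on q S \<longleftrightarrow> (\<forall>x\<in>S. x \<noteq> 0 \<longrightarrow> q x x < 0)"

definition nonpos_on :: "('a::real_vector \<Rightarrow> 'a \<Rightarrow> real) \<Rightarrow> 'a set \<Rightarrow> bool" where
  "nonpos_on q S \<longleftrightarrow> (\<forall>x\<in>S. q x x \<le> 0)"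

lemma posdef_imp_nondeg: "posdef_on q S \<Longrightarrow> nondeg_on q S"
  by (force simp: posdef_on_def nondeg_on_def)

lemma perp_subspace:
  assumes "symmetric_bilinear q" "subspace S"
  shows "subspace {x \<in> S. \<forall>w\<in>W. q w x = 0}"
  using assms by (auto simp: subspace_def sb_simps)

lemma perp_span:
  assumes "symmetric_bilinear q"
  shows "(\<forall>w\<in>span B. q w x = 0) \<longleftrightarrow> (\<forall>w\<in>B. q w x = 0)"
proof
  assume "\<forall>w\<in>B. q w x = 0"
  moreover have "subspace {w. q w x = 0}"
    using assms by (auto simp: subspace_def sb_simps)
  ultimately have "span B \<subseteq> {w. q w x = 0}" by (intro span_minimal) auto
  then show "\<forall>w\<in>span B. q w x = 0" by auto
qed (auto intro: span_base)

lemma dim_le_dim_perp: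
  assumes "symmetric_bilinear q" "fin_dim S" "subspace S" "fin_dim W" "subspace W"
  shows "dim S \<le> dim {x \<in> S. \<forall>w\<in>W. q w x = 0} + dim W"
proof -
  obtain B where B: "finite B" "span B = W" "card B = dim W"
    by (rule fin_dim_basis[OF assms(4,5)])
  have "{x \<in> S. \<forall>w\<in>W. q w x = 0} = {x \<in> S. \<forall>w\<in>B. q w x = 0}"
    using perp_span[OF assms(1), of B] unfolding B(2) by simp
  then show ?thesis
    using dim_le_dim_joint_kernel[OF B(1) assms(2,3), of q] sb_linear[OF assms(1)] B(3) by simp
qed

text \<open>
A nondegenerate \<open>W\<close> meets its \<open>q\<close>-orthogonal complement trivially, and
the two dimensions add up to the whole.
\<close>

lemma nondeg_projection:
  assumes q: "symmetric_bilinear q" and W: "fin_dim W" "subspace W" "nondeg_on q W"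
  obtains w where "w \<in> W" "\<forall>x\<in>W. q x (v - w) = 0"
proof -
  let ?S = "span (insert v W)"
  let ?K = "{x \<in> ?S. \<forall>w\<in>W. q w x = 0}"
  have S: "fin_dim ?S" using fin_dim_span_insert[OF W(1)] .
  have WS: "W \<subseteq> ?S" by (meson span_superset subset_insertI subset_trans)
  have vS: "v \<in> ?S" by (simp add: span_base)
  have K: "subspace ?K" using perp_subspace[OF q] subspace_span by blast
  have triv: "W \<inter> ?K \<subseteq> {0}" using W(3) sb_sym[OF q] by (force simp: nondeg_on_def)
  have d: "dim ?S \<le> dim W + dim ?K"
    using dim_le_dim_perp[OF q S subspace_span W(1,2)] by simp
  have KS: "?K \<subseteq> ?S" by blast
  obtain t p where tp: "t \<in> W" "p \<in> ?K" "v = t + p"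
    by (rule sum_of_complementary[OF S subspace_span WS KS W(2) K triv d vS])
  show ?thesis
  proof (rule that[OF tp(1)])
    show "\<forall>x\<in>W. q x (v - t) = 0" using tp(2,3) by simp
  qed
qed

text \<open>
With \<open>u\<close> spanning the \<open>q\<close>-orthogonal complement of the kernel of \<open>f\<close>, every vector is \<open>k + s *\<^sub>R u\<close>
with \<open>f k = 0\<close>, and \<open>q x x = q k k + s\<^sup>2 * q u u\<close> controls \<open>s\<close>.
\<close>

lemma linear_bounded_by_posdef:
  fixes f :: "'a::real_vector \<Rightarrow> real"
  assumes q: "symmetric_bilinear q" and S: "fin_dim S" "subspace S" "posdef_on q S"
    and f: "linear f"
  obtains C where "0 \<le> C" "\<And>x. x \<in> S \<Longrightarrow> (f x)\<^sup>2 \<le> C * q x x"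
proof (cases "\<exists>v\<in>S. f v \<noteq> 0")
  case False
  then show ?thesis using that[of 0] by auto
next
  case True
  then obtain v where v: "v \<in> S" "f v \<noteq> 0" by auto
  let ?K = "{x \<in> S. f x = 0}"
  have K: "subspace ?K" "fin_dim ?K" using subspace_kernel_in[OF S(2) f] fin_dim_subset[OF S(1), of ?K] by auto
  have pK: "posdef_on q ?K" using S(3) by (auto simp: posdef_on_def)
  obtain w where w: "w \<in> ?K" "\<forall>x\<in>?K. q x (v - w) = 0"
    by (rule nondeg_projection[OF q K(2,1) posdef_imp_nondeg[OF pK], of v])
  define u where "u = v - w"
  have u: "u \<in> S" "f u \<noteq> 0" using v w S(2) f by (auto simp: u_def subspace_diff linear_diff)
  have "u \<noteq> 0" using u(2) linear_0[OF f] by auto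
  then have qu: "0 < q u u" using S(3) u(1) by (auto simp: posdef_on_def)
  show ?thesis
  proof (rule that)
    show "0 \<le> (f u)\<^sup>2 / q u u" using qu by simp
    fix x assume x: "x \<in> S"
    define s where "s = f x / f u"
    define k where "k = x - s *\<^sub>R u"
    have k: "k \<in> ?K" using x u S(2) f
      by (auto simp: k_def s_def subspace_diff subspace_scale linear_diff linear_scale)
    have "0 \<le> q k k" using k pK sb_zero_left[OF q] by (cases "k = 0") (force simp: posdef_on_def)+
    have "x = k + s *\<^sub>R u" by (simp add: k_def)
    then have "q x x = q k k + s\<^sup>2 * q u u"
      using bspec[OF w(2) k] sb_add_self[OF q, of k "s *\<^sub>R u"]
      by (simp add: sb_scale_left[OF q] sb_scale_right[OF q] u_def[symmetric] power2_eq_square)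
    with \<open>0 \<le> q k k\<close> have "s\<^sup>2 * q u u \<le> q x x" by simp
    then have "(f u)\<^sup>2 / q u u * (s\<^sup>2 * q u u) \<le> (f u)\<^sup>2 / q u u * q x x"
      using qu by (intro mult_left_mono) auto
    moreover have "(f x)\<^sup>2 = (f u)\<^sup>2 / q u u * (s\<^sup>2 * q u u)"
      using qu u(2) by (simp add: s_def power_divide)
    ultimately show "(f x)\<^sup>2 \<le> (f u)\<^sup>2 / q u u * q x x" by simp
  qed
qed

text \<open>
Instead of compactness of the unit sphere, one vector at a time is split off orthogonally; the mixed
term is controlled by \<open>linear_bounded_by_posdef\<close>.
\<close>

lemma form_bounded_by_posdef:
  assumes q: "symmetric_bilinear q" and r: "symmetric_bilinear r"
    and S: "fin_dim S" "subspace S" "posdef_on q S"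
  shows "\<exists>C\<ge>0. \<forall>x\<in>S. \<bar>r x x\<bar> \<le> C * q x x"
  using S
proof (induction "dim S" arbitrary: S rule: less_induct)
  case (less S)
  show ?case
  proof (cases "\<exists>u\<in>S. u \<noteq> 0")
    case False
    then show ?thesis using sb_zero_left[OF r] sb_zero_left[OF q] by (auto intro!: exI[of _ 0])
  next
    case True
    then obtain u where u: "u \<in> S" "u \<noteq> 0" by auto
    let ?K = "{x \<in> S. q u x = 0}"
    have K: "subspace ?K" "fin_dim ?K"
      using subspace_kernel_in[OF less(3) sb_linear[OF q]] fin_dim_subset[OF less(2), of ?K] by auto
    have pK: "posdef_on q ?K" using less(4) by (auto simp: posdef_on_def)
    have qu: "0 < q u u" using less(4) u by (auto simp: posdef_on_def)
    then have "Suc (dim ?K) = dim (span (insert u ?K))"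
      using K dim_span_insert_fin[OF K(2,1), of u] by auto
    moreover have "span (insert u ?K) \<subseteq> S" using less(3) u by (intro span_minimal) auto
    ultimately have "dim ?K < dim S" using dim_mono_fin[OF less(2), of "span (insert u ?K)"] by linarith
    with less(1)[of ?K] K pK obtain C where C: "0 \<le> C" "\<And>x. x \<in> ?K \<Longrightarrow> \<bar>r x x\<bar> \<le> C * q x x"
      by blast
    obtain D where D: "0 \<le> D" "\<And>x. x \<in> ?K \<Longrightarrow> (r u x)\<^sup>2 \<le> D * q x x"
      using linear_bounded_by_posdef[OF q K(2,1) pK sb_linear[OF r]] by blast
    define E where "E = (1 + \<bar>r u u\<bar>) / q u u"
    have E: "0 \<le> E" using qu by (simp add: E_def)
    have "\<bar>r x x\<bar> \<le> (C + D + E) * q x x" if x: "x \<in> S" for x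
    proof -
      define s where "s = q u x / q u u"
      define k where "k = x - s *\<^sub>R u"
      have k: "k \<in> ?K" using x u less(3) qu
        by (auto simp: k_def s_def subspace_diff subspace_scale sb_simps[OF q])
      have qk: "0 \<le> q k k" using k pK sb_zero_left[OF q] by (cases "k = 0") (force simp: posdef_on_def)+
      have xk: "x = k + s *\<^sub>R u" by (simp add: k_def)
      have qx: "q x x = q k k + s\<^sup>2 * q u u"
        unfolding xk using k sb_sym[OF q, of k u] unfolding sb_add_self[OF q] by (simp add: sb_simps[OF q] power2_eq_square)
      have rx: "r x x = r k k + 2 * (s * r u k) + s\<^sup>2 * r u u"
        unfolding xk using sb_sym[OF r, of k u] unfolding sb_add_self[OF r] by (simp add: sb_simps[OF r] power2_eq_square)
      have "\<bar>2 * (s * r u k)\<bar> \<le> s\<^sup>2 + (r u k)\<^sup>2"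
        using zero_le_power2[of "\<bar>s\<bar> - \<bar>r u k\<bar>"] by (simp add: power2_diff abs_mult)
      also have "\<dots> \<le> s\<^sup>2 + D * q k k" using D(2)[OF k] by simp
      finally have 1: "\<bar>2 * (s * r u k)\<bar> \<le> s\<^sup>2 + D * q k k" .
      have 2: "\<bar>s\<^sup>2 * r u u\<bar> = s\<^sup>2 * \<bar>r u u\<bar>" by (simp add: abs_mult)
      have 3: "\<bar>r k k\<bar> \<le> C * q k k" using C(2)[OF k] .
      have "\<bar>r x x\<bar> \<le> C * q k k + (s\<^sup>2 + D * q k k) + s\<^sup>2 * \<bar>r u u\<bar>"
        unfolding rx using 1 2 3 by linarith
      also have "\<dots> = (C + D) * q k k + E * (s\<^sup>2 * q u u)"
        using qu by (simp add: E_def field_simps)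
      also have "\<dots> \<le> (C + D + E) * q k k + (C + D + E) * (s\<^sup>2 * q u u)"
        using qk qu C(1) D(1) E by (intro add_mono[OF mult_right_mono mult_right_mono]) auto
      also have "\<dots> = (C + D + E) * q x x" unfolding qx by (simp add: algebra_simps)
      finally show ?thesis .
    qed
    then show ?thesis using C(1) D(1) E by (intro exI[of _ "C + D + E"]) auto
  qed
qed

lemma posdef_on_open:
  assumes q: "symmetric_bilinear q" and r: "symmetric_bilinear r"
    and S: "fin_dim S" "subspace S" "posdef_on q S"
  obtains \<delta> where "0 < \<delta>" "\<forall>t. \<bar>t\<bar> < \<delta> \<longrightarrow> posdef_on (\<lambda>u v. q u v - t * r u v) S"
proof -
  obtain C where C: "0 \<le> C" "\<And>x. x \<in> S \<Longrightarrow> \<bar>r x x\<bar> \<le> C * q x x"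
    using form_bounded_by_posdef[OF q r S] by blast
  show ?thesis
  proof (rule that[of "1 / (C + 1)"]; (intro allI impI)?)
    show "0 < 1 / (C + 1)" using C(1) by simp
    fix t :: real assume t: "\<bar>t\<bar> < 1 / (C + 1)"
    then have t: "\<bar>t\<bar> * (C + 1) < 1" using C(1) by (simp add: field_simps)
    then have tC: "\<bar>t\<bar> * C < 1" using abs_ge_zero[of t] unfolding distrib_left by linarith
    show "posdef_on (\<lambda>u v. q u v - t * r u v) S"
      unfolding posdef_on_def
    proof (intro ballI impI)
      fix x assume x: "x \<in> S" "x \<noteq> 0"
      have qx: "0 < q x x" using S(3) x by (auto simp: posdef_on_def)
      have "t * r x x \<le> \<bar>t\<bar> * \<bar>r x x\<bar>" by (metis abs_ge_self abs_mult)
      also have "\<dots> \<le> \<bar>t\<bar> * (C * q x x)" using C(2)[OF x(1)] by (intro mult_left_mono) auto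
      also have "\<dots> = (\<bar>t\<bar> * C) * q x x" by simp
      also have "\<dots> < 1 * q x x" using tC qx by (intro mult_strict_right_mono)
      finally show "0 < q x x - t * r x x" by simp
    qed
  qed
qed

lemma negdef_iff_posdef_uminus: "negdef_on q S \<longleftrightarrow> posdef_on (\<lambda>u v. - q u v) S"
  by (simp add: negdef_on_def posdef_on_def)

lemma negdef_on_open:
  assumes q: "symmetric_bilinear q" and r: "symmetric_bilinear r"
    and S: "fin_dim S" "subspace S" "negdef_on q S"
  obtains \<delta> where "0 < \<delta>" "\<forall>t. \<bar>t\<bar> < \<delta> \<longrightarrow> negdef_on (\<lambda>u v. q u v - t * r u v) S"
proof -
  have p: "posdef_on (\<lambda>u v. - q u v) S" using S(3) by (simp add: negdef_iff_posdef_uminus)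
  obtain \<delta> where \<delta>: "0 < \<delta>" "\<forall>t. \<bar>t\<bar> < \<delta> \<longrightarrow> posdef_on (\<lambda>u v. - q u v - t * r u v) S"
    by (rule posdef_on_open[OF sb_uminus[OF q] r S(1,2) p])
  have "negdef_on (\<lambda>u v. q u v - t * r u v) S" if "\<bar>t\<bar> < \<delta>" for t
    using \<delta>(2)[rule_format, of "-t"] that by (simp add: negdef_iff_posdef_uminus algebra_simps)
  then show ?thesis using that[OF \<delta>(1)] by blast
qed

text \<open>
The Morse index of \<open>q\<close> on \<open>S\<close>.
\<close>

definition negative_index :: "('a::real_vector \<Rightarrow> 'a \<Rightarrow> real) \<Rightarrow> 'a set \<Rightarrow> nat" where
  "negative_index q S = Max {dim N | N. subspace N \<and> N \<subseteq> S \<and> negdef_on q N}"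

text \<open>
A certificate for the index: a negative and a positive definite subspace that together have
the full dimension. Definiteness is an open condition, so a certificate survives small changes of \<open>q\<close>.
\<close>

definition splits_on where
  "splits_on q S N P \<longleftrightarrow> subspace N \<and> subspace P \<and> N \<subseteq> S \<and> P \<subseteq> S \<and>
     negdef_on q N \<and> posdef_on q P \<and> dim S \<le> dim N + dim P"

lemma negdef_le_negative_index:
  assumes "fin_dim S" "subspace N" "N \<subseteq> S" "negdef_on q N"
  shows "dim N \<le> negative_index q S"
  unfolding negative_index_def
proof (rule Max_ge)
  have "{dim N | N. subspace N \<and> N \<subseteq> S \<and> negdef_on q N} \<subseteq> {..dim S}"
    using dim_mono_fin[OF assms(1)] by auto
  then show "finite {dim N | N. subspace N \<and> N \<subseteq> S \<and> negdef_on q N}"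
    using finite_subset by blast
qed (use assms in auto)

text \<open>
Sylvester's law of inertia: a negative definite subspace meets \<open>P\<close> trivially, so its dimension is
at most the codimension of \<open>P\<close>.
\<close>

lemma negative_index_eqI:
  assumes S: "fin_dim S" and sp: "splits_on q S N P"
  shows "negative_index q S = dim N"
  unfolding negative_index_def
proof (rule Max_eqI)
  let ?A = "{dim N | N. subspace N \<and> N \<subseteq> S \<and> negdef_on q N}"
  have "?A \<subseteq> {..dim S}" using dim_mono_fin[OF assms(1)] by auto
  then show "finite ?A" using finite_subset by blast
  show "dim N \<in> ?A" using sp by (auto simp: splits_on_def)
  fix d assume "d \<in> ?A"
  then obtain M where M: "d = dim M" "subspace M" "M \<subseteq> S" "negdef_on q M" by auto
  have "M \<inter> P \<subseteq> {0}"
    using M(4) sp by (force simp: splits_on_def negdef_on_def posdef_on_def)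
  then have "dim M + dim P \<le> dim S"
    using dim_add_le_of_trivial_meet[OF S M(3) _ M(2), of P] sp by (simp add: splits_on_def)
  then show "d \<le> dim N" using sp M(1) by (auto simp: splits_on_def)
qed

lemma splits_imp_nondeg:
  assumes q: "symmetric_bilinear q" and S: "fin_dim S" "subspace S" and sp: "splits_on q S N P"
  shows "nondeg_on q S"
  unfolding nondeg_on_def
proof (intro ballI impI)
  fix u assume u: "u \<in> S" "\<forall>v\<in>S. q u v = 0"
  have s: "subspace N" "subspace P" "N \<subseteq> S" "P \<subseteq> S" "negdef_on q N" "posdef_on q P"
    "dim S \<le> dim N + dim P" using sp by (auto simp: splits_on_def)
  have triv: "N \<inter> P \<subseteq> {0}" using s(5,6) by (force simp: negdef_on_def posdef_on_def)
  obtain n p where np: "n \<in> N" "p \<in> P" "u = n + p"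
    by (rule sum_of_complementary[OF S s(3,4,1,2) triv s(7) u(1)])
  have "q u n = 0" "q u p = 0" using u(2) np s by auto
  then have "q n n = q p p" using np(3) sb_sym[OF q, of n p] by (simp add: sb_simps[OF q])
  moreover have "n \<noteq> 0 \<Longrightarrow> q n n < 0" "p \<noteq> 0 \<Longrightarrow> 0 < q p p"
    using np s(5,6) by (auto simp: negdef_on_def posdef_on_def)
  ultimately have "n = 0" "p = 0"
    by (cases "n = 0"; cases "p = 0"; simp add: sb_zero_left[OF q])+
  with np show "u = 0" by simp
qed

lemma posdef_on_span_insert:
  assumes q: "symmetric_bilinear q" and P: "fin_dim P" "subspace P" "posdef_on q P"
    and x: "0 < q x x" "\<And>y. y \<in> P \<Longrightarrow> q x y = 0"
  shows "posdef_on q (span (insert x P))" "dim (span (insert x P)) = Suc (dim P)"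
proof -
  show "dim (span (insert x P)) = Suc (dim P)"
    using x by (intro dim_span_insert_fin P) force
  show "posdef_on q (span (insert x P))"
    unfolding posdef_on_def
  proof (intro ballI impI)
    fix z assume z: "z \<in> span (insert x P)" "z \<noteq> 0"
    then obtain s where s: "z - s *\<^sub>R x \<in> P" using P(2) by (auto simp: span_insert span_eq_iff[THEN iffD2])
    define y where "y = z - s *\<^sub>R x"
    have y: "y \<in> P" using s by (simp add: y_def)
    have zy: "z = s *\<^sub>R x + y" by (simp add: y_def)
    have qz: "q z z = s\<^sup>2 * q x x + q y y"
      unfolding zy using x(2)[OF y] unfolding sb_add_self[OF q] by (simp add: sb_simps[OF q] power2_eq_square)
    show "0 < q z z"
    proof (cases "y = 0")
      case True
      then have "s \<noteq> 0" using z(2) zy by auto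
      then show ?thesis using qz True x(1) by (simp add: sb_zero_left[OF q])
    next
      case False
      then have "0 < q y y" using P(3) y by (auto simp: posdef_on_def)
      then show ?thesis using qz x(1) by (simp add: add_nonneg_pos)
    qed
  qed
qed

lemma negdef_on_span_insert:
  assumes q: "symmetric_bilinear q" and P: "fin_dim P" "subspace P" "negdef_on q P"
    and x: "q x x < 0" "\<And>y. y \<in> P \<Longrightarrow> q x y = 0"
  shows "negdef_on q (span (insert x P))" "dim (span (insert x P)) = Suc (dim P)"
  using posdef_on_span_insert[OF sb_uminus[OF q] P(1,2), of x] P(3) x
  by (auto simp: negdef_iff_posdef_uminus)

text \<open>
Take \<open>P\<close> positive definite of maximal dimension. On its orthogonal complement \<open>q\<close> cannot be
positive anywhere, since such a vector could be added to \<open>P\<close>.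
\<close>

lemma exists_nonpos_posdef_split:
  assumes q: "symmetric_bilinear q" and S: "fin_dim S" "subspace S"
  obtains N P where "subspace N" "subspace P" "N \<subseteq> S" "P \<subseteq> S" "nonpos_on q N" "posdef_on q P"
    "dim S \<le> dim N + dim P" "\<forall>x\<in>N. \<forall>y\<in>P. q x y = 0"
proof -
  define good where "good d \<longleftrightarrow> (\<exists>P. subspace P \<and> P \<subseteq> S \<and> posdef_on q P \<and> dim P = d)" for d
  have "dim {0::'a} = 0" using dim_le_card[of "{0}" "{}"] by simp
  then have 0: "good 0" using subspace_0[OF S(2)] unfolding good_def
    by (intro exI[of _ "{0}"]) (auto simp: posdef_on_def)
  have bd: "\<And>d. good d \<Longrightarrow> d \<le> dim S" using dim_mono_fin[OF S(1)] by (auto simp: good_def)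
  define d where "d = Greatest good"
  have d: "good d" "\<And>d'. good d' \<Longrightarrow> d' \<le> d"
    unfolding d_def using GreatestI_nat[of good, OF 0] Greatest_le_nat[of good] bd by metis+
  obtain P where P: "subspace P" "P \<subseteq> S" "posdef_on q P" "dim P = d"
    using d(1) unfolding good_def by (elim exE conjE)
  let ?N = "{x \<in> S. \<forall>w\<in>P. q w x = 0}"
  have fP: "fin_dim P" using fin_dim_subset[OF S(1) P(2)] .
  have "nonpos_on q ?N"
    unfolding nonpos_on_def
  proof (intro ballI, rule ccontr)
    fix x assume x: "x \<in> ?N" "\<not> q x x \<le> 0"
    have *: "\<And>y. y \<in> P \<Longrightarrow> q x y = 0" using x(1) sb_sym[OF q] by auto
    have "0 < q x x" using x(2) by simp
    note new = posdef_on_span_insert[OF q fP P(1,3) this *]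
    have "span (insert x P) \<subseteq> S" using x(1) P(2) S(2) by (intro span_minimal) auto
    then have "good (Suc (dim P))" unfolding good_def using new
      by (intro exI[of _ "span (insert x P)"]) simp
    from d(2)[OF this] P(4) show False by simp
  qed
  moreover have "dim S \<le> dim ?N + dim P" by (rule dim_le_dim_perp[OF q S fP P(1)])
  ultimately show ?thesis
    using P perp_subspace[OF q S(2), of P] by (intro that[of ?N P]) (auto simp: sb_sym[OF q])
qed

lemma nondeg_imp_splits:
  assumes q: "symmetric_bilinear q" and S: "fin_dim S" "subspace S" and nd: "nondeg_on q S"
  obtains N P where "splits_on q S N P"
proof -
  obtain N P where s: "subspace N" "subspace P" "N \<subseteq> S" "P \<subseteq> S" "nonpos_on q N" "posdef_on q P"
    "dim S \<le> dim N + dim P" "\<forall>x\<in>N. \<forall>y\<in>P. q x y = 0"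
    by (rule exists_nonpos_posdef_split[OF q S])
  have triv: "N \<inter> P \<subseteq> {0}" using s(5,6) by (force simp: nonpos_on_def posdef_on_def)
  have "negdef_on q N"
    unfolding negdef_on_def
  proof (intro ballI impI, rule ccontr)
    fix x assume x: "x \<in> N" "x \<noteq> 0" "\<not> q x x < 0"
    then have x0: "q x x = 0" using s(5) by (force simp: nonpos_on_def)
    have xN: "q x y = 0" if "y \<in> N" for y
      using psd_zero_imp_radical[OF sb_uminus[OF q] s(1), of x y] s(5) x(1) x0 that
      by (auto simp: nonpos_on_def)
    have "q x v = 0" if v: "v \<in> S" for v
    proof -
      obtain n p where "n \<in> N" "p \<in> P" "v = n + p"
        by (rule sum_of_complementary[OF S s(3,4,1,2) triv s(7) v])
      then show ?thesis using xN s(8) x(1) by (simp add: sb_simps[OF q])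
    qed
    then show False using nd x(1,2) s(3) by (auto simp: nondeg_on_def)
  qed
  then show ?thesis using that s by (auto simp: splits_on_def)
qed

section \<open>Index drops along a pencil of forms\<close>

abbreviation pencil :: "('a::real_vector \<Rightarrow> 'a \<Rightarrow> real) \<Rightarrow> ('a \<Rightarrow> 'a \<Rightarrow> real) \<Rightarrow> real \<Rightarrow> 'a \<Rightarrow> 'a \<Rightarrow> real" where
  "pencil A B t \<equiv> (\<lambda>u v. A u v - t * B u v)"

lemma negative_index_split_line:
  assumes q: "symmetric_bilinear q" and S: "fin_dim S" "subspace S" "nondeg_on q S"
    and u: "u \<in> S" "q u u \<noteq> 0"
  defines "W \<equiv> {x \<in> S. q u x = 0}"
  shows "nondeg_on q W"
    and "negative_index q S = negative_index q W + (if q u u < 0 then 1 else 0)"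
proof -
  have W: "fin_dim W" "subspace W" "W \<subseteq> S"
    unfolding W_def using subspace_kernel_in[OF S(2) sb_linear[OF q]] fin_dim_subset[OF S(1)] by auto
  have d: "dim S \<le> Suc (dim W)"
    unfolding W_def by (rule dim_le_Suc_dim_kernel[OF S(1,2) sb_linear[OF q]])
  show nW: "nondeg_on q W"
    unfolding nondeg_on_def
  proof (intro ballI impI)
    fix w assume w: "w \<in> W" "\<forall>v\<in>W. q w v = 0"
    have wu: "q w u = 0" using w(1) sb_sym[OF q, of w u] by (simp add: W_def)
    have "q w x = 0" if x: "x \<in> S" for x
    proof -
      have "x - (q u x / q u u) *\<^sub>R u \<in> W"
        using x u S(2) by (simp add: W_def sb_simps[OF q] subspace_diff subspace_scale)
      with w(2) have "q w (x - (q u x / q u u) *\<^sub>R u) = 0" by blast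
      then show ?thesis using wu by (simp add: sb_simps[OF q])
    qed
    then show "w = 0" using S(3) w(1) W(3) unfolding nondeg_on_def by blast
  qed
  obtain N P where sp: "splits_on q W N P"
    by (rule nondeg_imp_splits[OF q W(1,2) nW])
  then have s: "subspace N" "subspace P" "N \<subseteq> W" "P \<subseteq> W" "negdef_on q N" "posdef_on q P"
    "dim W \<le> dim N + dim P" by (auto simp: splits_on_def)
  have f: "fin_dim N" "fin_dim P" using s W(1) fin_dim_subset by blast+
  have perp: "q u y = 0" if "y \<in> W" for y using that by (simp add: W_def)
  have iW: "negative_index q W = dim N" by (rule negative_index_eqI[OF W(1) sp])
  have NS: "N \<subseteq> S" "P \<subseteq> S" using s W by auto
  show "negative_index q S = negative_index q W + (if q u u < 0 then 1 else 0)"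
  proof (cases "q u u < 0")
    case True
    have pN: "q u y = 0" if "y \<in> N" for y using that s(3) perp by blast
    note new = negdef_on_span_insert[OF q f(1) s(1,5) True pN]
    have "span (insert u N) \<subseteq> S" using u NS S(2) by (intro span_minimal) auto
    then have "splits_on q S (span (insert u N)) P"
      using new s NS d by (simp add: splits_on_def)
    then show ?thesis using negative_index_eqI[OF S(1)] new(2) iW True by simp
  next
    case False
    then have pos: "0 < q u u" using u(2) by simp
    have pP: "q u y = 0" if "y \<in> P" for y using that s(4) perp by blast
    note new = posdef_on_span_insert[OF q f(2) s(2,6) pos pP]
    have "span (insert u P) \<subseteq> S" using u NS S(2) by (intro span_minimal) auto
    then have "splits_on q S N (span (insert u P))"
      using new s NS d by (simp add: splits_on_def)
    then show ?thesis using negative_index_eqI[OF S(1)] iW False by simp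
  qed
qed

text \<open>
Modulo \<open>W\<close> the isotropic vector \<open>u\<close> and a partner \<open>v\<close> with \<open>q u v \<noteq> 0\<close> span a hyperbolic plane, which
contributes one negative and one positive direction. The space \<open>W\<close> is an arbitrary complement of \<open>u\<close>
in the \<open>q\<close>-orthogonal space of \<open>u\<close>, so that one \<open>W\<close> can serve all members of a pencil; the partner is
made orthogonal to \<open>W\<close> inside the proof.
\<close>

lemma negative_index_split_hyperbolic:
  assumes q: "symmetric_bilinear q" and S: "fin_dim S" "subspace S" "nondeg_on q S"
    and u: "u \<in> S" "q u u = 0" and v: "v \<in> S" "q u v \<noteq> 0"
    and W: "subspace W" "W \<subseteq> {x \<in> S. q u x = 0}" "u \<notin> W"
    and compl: "\<And>x. x \<in> S \<Longrightarrow> q u x = 0 \<Longrightarrow> \<exists>c. x - c *\<^sub>R u \<in> W"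
  shows "nondeg_on q W" and "negative_index q S = Suc (negative_index q W)"
proof -
  let ?H = "{x \<in> S. q u x = 0}"
  have WS: "W \<subseteq> S" using W(2) by auto
  have fW: "fin_dim W" using fin_dim_subset[OF S(1) WS] .
  have "?H \<subseteq> span (insert u W)"
    using compl by (auto simp: span_insert intro: span_base)
  then have "dim ?H \<le> dim (span (insert u W))"
    using dim_mono_fin fin_dim_span_insert[OF fW] by blast
  also have "\<dots> = Suc (dim W)" by (rule dim_span_insert_fin[OF fW W(1,3)])
  finally have d: "dim S \<le> Suc (Suc (dim W))"
    using dim_le_Suc_dim_kernel[OF S(1,2) sb_linear[OF q], of u] by linarith
  have perp: "q u y = 0" if "y \<in> W" for y using that W(2) by auto
  show nW: "nondeg_on q W"
    unfolding nondeg_on_def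
  proof (intro ballI impI)
    fix w assume w: "w \<in> W" "\<forall>y\<in>W. q w y = 0"
    have wu: "q w u = 0" using perp[OF w(1)] sb_sym[OF q, of w u] by simp
    have wH: "q w x = 0" if x: "x \<in> S" "q u x = 0" for x
    proof -
      obtain c where "x - c *\<^sub>R u \<in> W" using compl[OF x] by blast
      with w(2) have "q w (x - c *\<^sub>R u) = 0" by blast
      then show ?thesis using wu by (simp add: sb_simps[OF q])
    qed
    define c where "c = q w v / q u v"
    have "q (w - c *\<^sub>R u) x = 0" if x: "x \<in> S" for x
    proof -
      define r where "r = q u x / q u v"
      have *: "q u (x - r *\<^sub>R v) = 0" using v by (simp add: sb_simps[OF q] r_def)
      have "q w (x - r *\<^sub>R v) = 0"
        using x v S(2) by (intro wH *) (simp add: subspace_diff subspace_scale)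
      then have "q w x = r * q w v" by (simp add: sb_simps[OF q])
      then show ?thesis using v(2) by (simp add: sb_simps[OF q] c_def r_def)
    qed
    moreover have "w - c *\<^sub>R u \<in> S" using w(1) WS u S(2) by (auto simp: subspace_diff subspace_scale)
    ultimately have wc: "w - c *\<^sub>R u = 0" using S(3) unfolding nondeg_on_def by blast
    show "w = 0"
    proof (rule ccontr)
      assume "w \<noteq> 0"
      then have "c \<noteq> 0" using wc by auto
      then have "u = (1 / c) *\<^sub>R w" using wc by simp
      then show False using W(1,3) w(1) by (simp add: subspace_scale)
    qed
  qed
  obtain w0 where w0: "w0 \<in> W" "\<forall>x\<in>W. q x (v - w0) = 0"
    by (rule nondeg_projection[OF q fW W(1) nW, of v])
  define v' where "v' = v - w0"
  have v': "v' \<in> S" "q u v' \<noteq> 0"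
    using v w0(1) WS S(2) perp[OF w0(1)] by (auto simp: v'_def subspace_diff sb_simps[OF q])
  have ex: "\<exists>x\<in>S. q x x = \<tau> \<and> (\<forall>y\<in>W. q x y = 0)" for \<tau>
  proof -
    define c where "c = (\<tau> - q v' v') / (2 * q u v')"
    have "q (v' + c *\<^sub>R u) (v' + c *\<^sub>R u) = q v' v' + 2 * c * q u v'"
      unfolding sb_add_self[OF q] using u(2) sb_sym[OF q, of v' u] by (simp add: sb_simps[OF q])
    also have "\<dots> = \<tau>" using v'(2) by (simp add: c_def field_simps)
    finally have "q (v' + c *\<^sub>R u) (v' + c *\<^sub>R u) = \<tau>" .
    moreover have "q (v' + c *\<^sub>R u) y = 0" if "y \<in> W" for y
      using bspec[OF w0(2) that] perp[OF that] sb_sym[OF q, of v' y]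
      by (simp add: sb_add_left[OF q] sb_scale_left[OF q] v'_def[symmetric])
    moreover have "v' + c *\<^sub>R u \<in> S" using v' u S(2) by (simp add: subspace_add subspace_scale)
    ultimately show ?thesis by blast
  qed
  obtain x where x: "x \<in> S" "q x x = - 1" "\<And>y. y \<in> W \<Longrightarrow> q x y = 0" using ex by blast
  obtain z where z: "z \<in> S" "q z z = 1" "\<And>y. y \<in> W \<Longrightarrow> q z y = 0" using ex by blast
  obtain N P where sp: "splits_on q W N P"
    by (rule nondeg_imp_splits[OF q fW W(1) nW])
  then have s: "subspace N" "subspace P" "N \<subseteq> W" "P \<subseteq> W" "negdef_on q N" "posdef_on q P"
    "dim W \<le> dim N + dim P" by (auto simp: splits_on_def)
  have f: "fin_dim N" "fin_dim P" using s fW fin_dim_subset by blast+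
  have qx: "q x x < 0" and qz: "0 < q z z" using x(2) z(2) by auto
  have xN: "q x y = 0" if "y \<in> N" for y using that s(3) x(3) by blast
  have zP: "q z y = 0" if "y \<in> P" for y using that s(4) z(3) by blast
  note nx = negdef_on_span_insert[OF q f(1) s(1,5) qx xN]
  note nz = posdef_on_span_insert[OF q f(2) s(2,6) qz zP]
  have "span (insert x N) \<subseteq> S" "span (insert z P) \<subseteq> S"
    using x(1) z(1) s(3,4) WS S(2) by (intro span_minimal; auto)+
  then have "splits_on q S (span (insert x N)) (span (insert z P))"
    using nx nz s d by (simp add: splits_on_def)
  then show "negative_index q S = Suc (negative_index q W)"
    using negative_index_eqI[OF S(1)] nx(2) negative_index_eqI[OF fW sp] by simp
qed

lemma negative_index_locally_constant:
  assumes A: "symmetric_bilinear A" and B: "symmetric_bilinear B" and S: "fin_dim S" "subspace S"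
    and nd: "nondeg_on (pencil A B l) S"
  shows "\<exists>\<delta>>0. \<forall>t. \<bar>t - l\<bar> < \<delta> \<longrightarrow> negative_index (pencil A B t) S = negative_index (pencil A B l) S"
proof -
  note q = sb_diff_scale[OF A B, of l]
  obtain N P where sp: "splits_on (pencil A B l) S N P"
    by (rule nondeg_imp_splits[OF q S nd])
  then have s: "subspace N" "subspace P" "N \<subseteq> S" "P \<subseteq> S" "negdef_on (pencil A B l) N"
    "posdef_on (pencil A B l) P" "dim S \<le> dim N + dim P" by (auto simp: splits_on_def)
  have f: "fin_dim N" "fin_dim P" using s S(1) fin_dim_subset by blast+
  obtain d1 where d1: "0 < d1" "\<forall>t. \<bar>t\<bar> < d1 \<longrightarrow> negdef_on (pencil (pencil A B l) B t) N"
    by (rule negdef_on_open[OF q B f(1) s(1,5)])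
  obtain d2 where d2: "0 < d2" "\<forall>t. \<bar>t\<bar> < d2 \<longrightarrow> posdef_on (pencil (pencil A B l) B t) P"
    by (rule posdef_on_open[OF q B f(2) s(2,6)])
  have eq: "pencil (pencil A B l) B (t - l) = pencil A B t" for t
    by (auto simp: fun_eq_iff algebra_simps)
  show ?thesis
  proof (intro exI[of _ "min d1 d2"] conjI allI impI)
    show "0 < min d1 d2" using d1(1) d2(1) by simp
    fix t assume t: "\<bar>t - l\<bar> < min d1 d2"
    have sp': "splits_on (pencil A B t) S N P"
      using d1(2)[rule_format, of "t - l"] d2(2)[rule_format, of "t - l"] t s unfolding eq by (simp add: splits_on_def)
    show "negative_index (pencil A B t) S = negative_index (pencil A B l) S"
      unfolding negative_index_eqI[OF S(1) sp] negative_index_eqI[OF S(1) sp'] ..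
  qed
qed

text \<open>
The index is locally constant where the pencil is nondegenerate, and the line is connected.
\<close>

lemma negative_index_constant:
  assumes A: "symmetric_bilinear A" and B: "symmetric_bilinear B" and S: "fin_dim S" "subspace S"
    and nd: "\<And>t. nondeg_on (pencil A B t) S"
  shows "negative_index (pencil A B s) S = negative_index (pencil A B t) S"
proof (rule connected_local_const[where A = UNIV and a = s and b = t and
      f = "\<lambda>r. negative_index (pencil A B r) S"])
  show "\<forall>l\<in>UNIV. \<forall>\<^sub>F t in at l. negative_index (pencil A B l) S = negative_index (pencil A B t) S"
  proof
    fix l :: real
    obtain \<delta> where \<delta>: "0 < \<delta>" "\<forall>t. \<bar>t - l\<bar> < \<delta> \<longrightarrow>
        negative_index (pencil A B t) S = negative_index (pencil A B l) S"
      using negative_index_locally_constant[OF A B S nd[of l]] by blast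
    show "\<forall>\<^sub>F t in at l. negative_index (pencil A B l) S = negative_index (pencil A B t) S"
      unfolding eventually_at
    proof (intro exI[of _ \<delta>] conjI ballI impI \<delta>(1))
      fix t assume "t \<noteq> l \<and> dist t l < \<delta>"
      then have "\<bar>t - l\<bar> < \<delta>" by (simp add: dist_real_def)
      then show "negative_index (pencil A B l) S = negative_index (pencil A B t) S"
        by (rule \<delta>(2)[rule_format, symmetric])
    qed
  qed
qed auto

text \<open>
A pair \<open>(s, t)\<close> encodes a step from \<open>s\<close> to \<open>t\<close>, to the right of \<open>l\<close> or to the left of \<open>l\<close>; a step may
start at \<open>l\<close> in either direction.
\<close>

definition outward :: "real \<Rightarrow> real \<times> real \<Rightarrow> bool" where
  "outward l p \<longleftrightarrow> l \<le> fst p \<and> fst p < snd p \<or> snd p < fst p \<and> fst p \<le> l"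

definition disjoint_steps :: "(real \<times> real) set \<Rightarrow> bool" where
  "disjoint_steps T \<longleftrightarrow> (\<forall>p\<in>T. \<forall>p'\<in>T. p \<noteq> p' \<longrightarrow>
     open_segment (fst p) (snd p) \<inter> open_segment (fst p') (snd p') = {})"

text \<open>
The index of the one-dimensional pencil \<open>(\<sigma> - t) * \<beta>\<close> jumps only at \<open>\<sigma>\<close>. Going away from \<open>l\<close> it
can fall only if it was \<open>1\<close> at \<open>l\<close>, and of the disjoint steps at most one passes over \<open>\<sigma>\<close>.
\<close>

lemma sum_drops_of_line:
  fixes \<sigma> l \<beta> :: real
  defines "e \<equiv> (\<lambda>t. if (\<sigma> - t) * \<beta> < 0 then 1 else (0::nat))"
  assumes T: "finite T" "\<And>p. p \<in> T \<Longrightarrow> outward l p" "disjoint_steps T"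
    and ne: "\<beta> \<noteq> 0" "\<sigma> \<noteq> l" "\<And>p. p \<in> T \<Longrightarrow> fst p \<noteq> \<sigma> \<and> snd p \<noteq> \<sigma>"
  shows "(\<Sum>p\<in>T. e (fst p) - e (snd p)) \<le> e l"
proof -
  let ?D = "{p \<in> T. e (fst p) - e (snd p) \<noteq> 0}"
  have D: "\<sigma> \<in> open_segment (fst p) (snd p) \<and> e l = 1" if p: "p \<in> ?D" for p
    using T(2)[of p] p ne(1,2) ne(3)[of p]
    by (auto simp: e_def outward_def open_segment_eq_real_ivl mult_less_0_iff split: if_splits)
  show ?thesis
  proof (cases "?D = {}")
    case True
    then have "\<forall>p\<in>T. e (fst p) - e (snd p) = 0" by blast
    then show ?thesis by simp
  next
    case False
    then obtain p where p: "p \<in> ?D" by blast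
    have "?D = {p}"
    proof -
      have "p' = p" if "p' \<in> ?D" for p'
        using D[OF that] D[OF p] T(3) p that unfolding disjoint_steps_def by blast
      then show ?thesis using p by blast
    qed
    have "(\<Sum>p\<in>T. e (fst p) - e (snd p)) = (\<Sum>p\<in>?D. e (fst p) - e (snd p))"
      using T(1) by (intro sum.mono_neutral_right) auto
    also have "\<dots> \<le> 1" unfolding \<open>?D = {p}\<close> by (simp add: e_def)
    finally show ?thesis using D[OF p] by simp
  qed
qed

text \<open>
Every fall of the index away from \<open>l\<close> uses up a negative direction of the form at \<open>l\<close>, however often
the index rises in between. The negative directions are collected by induction on the dimension. If no member of the pencil is degenerate, the index
is constant. Otherwise some \<open>u \<noteq> 0\<close> is in the radical of the member at \<open>\<sigma>\<close>, and then
\<open>pencil A B t u v = (\<sigma> - t) * B u v\<close> for all \<open>t\<close>, so that orthogonality to \<open>u\<close> means the same for all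
\<open>t \<noteq> \<sigma>\<close>. If \<open>B u u \<noteq> 0\<close>, the line of \<open>u\<close> splits off orthogonally and contributes at most its own
index at \<open>l\<close>. If \<open>B u u = 0\<close>, passing from \<open>S\<close> to the orthogonal space of \<open>u\<close> modulo \<open>u\<close> lowers the
index by exactly \<open>1\<close> at every \<open>t \<noteq> \<sigma>\<close>, so the drops are unchanged. The second case covers multiple
roots and crossings of higher order, where eigenvectors alone would not suffice.
\<close>

lemma sum_index_drops_le:
  assumes A: "symmetric_bilinear A" and B: "symmetric_bilinear B"
    and T: "finite T" "\<And>p. p \<in> T \<Longrightarrow> outward l p" "disjoint_steps T"
    and S: "fin_dim S" "subspace S"
    and ndl: "nondeg_on (pencil A B l) S"
    and nd: "\<And>p. p \<in> T \<Longrightarrow> nondeg_on (pencil A B (fst p)) S \<and> nondeg_on (pencil A B (snd p)) S"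
  shows "(\<Sum>p\<in>T. negative_index (pencil A B (fst p)) S - negative_index (pencil A B (snd p)) S)
           \<le> negative_index (pencil A B l) S"
  using S ndl nd
proof (induction "dim S" arbitrary: S rule: less_induct)
  case (less S)
  note S = less(2,3)
  note nd = less(5)
  let ?Q = "pencil A B"
  note Q = sb_diff_scale[OF A B]
  show ?case
  proof (cases "\<forall>t. nondeg_on (?Q t) S")
    case True
    then have nd': "nondeg_on (?Q t) S" for t by blast
    have eq: "negative_index (?Q s) S - negative_index (?Q t) S = 0" for s t
      unfolding negative_index_constant[OF A B S nd', of s t] by (rule diff_self_eq_0)
    show ?thesis unfolding eq by simp
  next
    case False
    then obtain \<sigma> u where u: "u \<in> S" "u \<noteq> 0" and \<sigma>: "\<And>v. v \<in> S \<Longrightarrow> ?Q \<sigma> u v = 0"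
      by (auto simp: nondeg_on_def)
    have Qu: "?Q t u v = (\<sigma> - t) * B u v" if "v \<in> S" for t v
      using \<sigma>[OF that] by (simp add: algebra_simps)
    have ne: "t \<noteq> \<sigma>" if "nondeg_on (?Q t) S" for t
      using that u \<sigma> by (auto simp: nondeg_on_def)
    have Qu0: "?Q t u v = 0 \<longleftrightarrow> B u v = 0" if "v \<in> S" "nondeg_on (?Q t) S" for t v
      unfolding Qu[OF that(1)] using ne[OF that(2)] by simp
    have B0: "\<exists>v\<in>S. B u v \<noteq> 0"
    proof (rule ccontr)
      assume "\<not> ?thesis"
      then have "\<forall>v\<in>S. ?Q l u v = 0" using Qu by auto
      then show False using less(4) u unfolding nondeg_on_def by blast
    qed
    have smaller: "dim W < dim S" if W: "subspace W" "W \<subseteq> S" "u \<notin> W" for W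
    proof -
      have fW: "fin_dim W" using fin_dim_subset[OF S(1) W(2)] .
      have "span (insert u W) \<subseteq> S" using u W S(2) by (intro span_minimal) auto
      then have "dim (span (insert u W)) \<le> dim S" by (rule dim_mono_fin[OF S(1)])
      then show ?thesis using dim_span_insert_fin[OF fW W(1,3)] by simp
    qed
    show ?thesis
    proof (cases "B u u = 0")
      case False
      let ?W = "{x \<in> S. B u x = 0}"
      have W: "subspace ?W" "fin_dim ?W"
        using subspace_kernel_in[OF S(2) sb_linear[OF B]] fin_dim_subset[OF S(1), of ?W] by auto
      have dW: "dim ?W < dim S" using smaller[OF W(1)] False by auto
      define e where "e t = (if (\<sigma> - t) * B u u < 0 then 1 else (0::nat))" for t
      have step: "nondeg_on (?Q t) ?W" "negative_index (?Q t) S = negative_index (?Q t) ?W + e t"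
        if t: "nondeg_on (?Q t) S" for t
      proof -
        have W_eq: "{x \<in> S. ?Q t u x = 0} = ?W" using Qu0[OF _ t] by blast
        have nz: "?Q t u u \<noteq> 0" unfolding Qu0[OF u(1) t] by (rule False)
        show "nondeg_on (?Q t) ?W"
          using negative_index_split_line(1)[OF Q S t u(1) nz] unfolding W_eq .
        show "negative_index (?Q t) S = negative_index (?Q t) ?W + e t"
          using negative_index_split_line(2)[OF Q S t u(1) nz] unfolding W_eq
          by (simp only: e_def Qu[OF u(1)])
      qed
      have "(\<Sum>p\<in>T. negative_index (?Q (fst p)) S - negative_index (?Q (snd p)) S)
        \<le> (\<Sum>p\<in>T. (negative_index (?Q (fst p)) ?W - negative_index (?Q (snd p)) ?W)
                + (e (fst p) - e (snd p)))"
      proof (rule sum_mono)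
        fix p assume p: "p \<in> T"
        show "negative_index (?Q (fst p)) S - negative_index (?Q (snd p)) S
          \<le> (negative_index (?Q (fst p)) ?W - negative_index (?Q (snd p)) ?W)
                + (e (fst p) - e (snd p))"
          using step(2)[of "fst p"] step(2)[of "snd p"] nd[OF p] by linarith
      qed
      also have "\<dots> = (\<Sum>p\<in>T. negative_index (?Q (fst p)) ?W - negative_index (?Q (snd p)) ?W)
                + (\<Sum>p\<in>T. e (fst p) - e (snd p))" by (rule sum.distrib)
      also have "\<dots> \<le> negative_index (?Q l) ?W + e l"
      proof (rule add_mono)
        show "(\<Sum>p\<in>T. negative_index (?Q (fst p)) ?W - negative_index (?Q (snd p)) ?W)
            \<le> negative_index (?Q l) ?W"
          using less(1)[OF dW W(2,1)] step(1) less(4) nd by blast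
        show "(\<Sum>p\<in>T. e (fst p) - e (snd p)) \<le> e l"
          unfolding e_def using ne less(4) nd False
          by (intro sum_drops_of_line[OF T]) blast+
      qed
      also have "\<dots> = negative_index (?Q l) S" using step(2)[OF less(4)] by simp
      finally show ?thesis .
    next
      case True
      obtain v where v: "v \<in> S" "B u v \<noteq> 0" using B0 by blast
      \<comment> \<open>As \<open>B v u \<noteq> 0\<close>, the second equation selects a complement of \<open>u\<close>.\<close>
      let ?W = "{x \<in> S. B u x = 0 \<and> B v x = 0}"
      have W: "subspace ?W" using S(2) by (auto simp: subspace_def sb_simps[OF B])
      have fW: "fin_dim ?W" using fin_dim_subset[OF S(1), of ?W] by auto
      have uW: "u \<notin> ?W" using v sb_sym[OF B, of u v] by auto
      have dW: "dim ?W < dim S" using smaller[OF W _ uW] by auto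
      have step: "nondeg_on (?Q t) ?W \<and> negative_index (?Q t) S = Suc (negative_index (?Q t) ?W)"
        if t: "nondeg_on (?Q t) S" for t
      proof -
        have 1: "?Q t u u = 0" unfolding Qu0[OF u(1) t] by (rule True)
        have 2: "?Q t u v \<noteq> 0" unfolding Qu0[OF v(1) t] by (rule v(2))
        have 3: "?W \<subseteq> {x \<in> S. ?Q t u x = 0}" using Qu0[OF _ t] by blast
        have 4: "\<exists>c. x - c *\<^sub>R u \<in> ?W" if x: "x \<in> S" "?Q t u x = 0" for x
        proof
          have "B u x = 0" using x(2) unfolding Qu0[OF x(1) t] .
          then show "x - (B v x / B u v) *\<^sub>R u \<in> ?W"
            using x u v S(2) True sb_sym[OF B, of v u]
            by (simp add: subspace_diff subspace_scale sb_simps[OF B])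
        qed
        show ?thesis
          using negative_index_split_hyperbolic[OF Q S t u(1) 1 v(1) 2 W 3 uW 4] by blast
      qed
      have "(\<Sum>p\<in>T. negative_index (?Q (fst p)) S - negative_index (?Q (snd p)) S)
         = (\<Sum>p\<in>T. negative_index (?Q (fst p)) ?W - negative_index (?Q (snd p)) ?W)"
        using step nd by (intro sum.cong) auto
      also have "\<dots> \<le> negative_index (?Q l) ?W"
        using less(1)[OF dW fW W] step less(4) nd by blast
      also have "\<dots> \<le> negative_index (?Q l) S" using step less(4) by simp
      finally show ?thesis .
    qed
  qed
qed

section \<open>Weak convergence in Hilbert space\<close>

lemma symmetric_bilinear_inner: "symmetric_bilinear (inner :: 'a::real_inner \<Rightarrow> 'a \<Rightarrow> real)"
  by (rule symmetric_bilinearI, rule linearI) (simp_all add: inner_add_right inner_commute)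

lemma parallelogram: "(norm (x + y))\<^sup>2 + (norm (x - y))\<^sup>2 = 2 * (norm x)\<^sup>2 + 2 * (norm (y::'a::real_inner))\<^sup>2"
  by (simp add: dot_square_norm[symmetric] inner_add_left inner_add_right inner_diff_left
      inner_diff_right inner_commute)

lemma bounded_bilinear_of_quadratic_bound:
  fixes q :: "'a::real_inner \<Rightarrow> 'a \<Rightarrow> real"
  assumes q: "symmetric_bilinear q" and C: "\<And>u. \<bar>q u u\<bar> \<le> C * (norm u)\<^sup>2"
  shows "bounded_bilinear q"
proof -
  have 1: "2 * \<bar>q u v\<bar> \<le> C * ((norm u)\<^sup>2 + (norm v)\<^sup>2)" for u v
  proof -
    have "q (u - v) (u - v) = q u u - 2 * q u v + q v v"
      using sb_add_self[OF q, of u "- v"] sb_scale_left[OF q, of "-1" v] sb_scale_right[OF q, of _ "-1" v]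
      by simp
    then have "4 * \<bar>q u v\<bar> = \<bar>q (u + v) (u + v) - q (u - v) (u - v)\<bar>"
      using sb_add_self[OF q, of u v] by simp
    also have "\<dots> \<le> \<bar>q (u + v) (u + v)\<bar> + \<bar>q (u - v) (u - v)\<bar>" by (rule abs_triangle_ineq4)
    also have "\<dots> \<le> C * (norm (u + v))\<^sup>2 + C * (norm (u - v))\<^sup>2" by (intro add_mono C)
    also have "\<dots> = C * ((norm (u + v))\<^sup>2 + (norm (u - v))\<^sup>2)" by (simp only: distrib_left)
    also have "\<dots> = 2 * (C * ((norm u)\<^sup>2 + (norm v)\<^sup>2))"
      unfolding parallelogram by (simp add: algebra_simps)
    finally show ?thesis by simp
  qed
  have 2: "\<bar>q u v\<bar> \<le> norm u * norm v * C" for u v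
  proof (cases "u = 0 \<or> v = 0")
    case True
    then show ?thesis by (auto simp: sb_zero_left[OF q] sb_zero_right[OF q])
  next
    case False
    then have p: "0 < norm u * norm v" by simp
    have "2 * \<bar>q (u /\<^sub>R norm u) (v /\<^sub>R norm v)\<bar> \<le> C * (1 + 1)"
      using 1[of "u /\<^sub>R norm u" "v /\<^sub>R norm v"] False by simp
    moreover have "q (u /\<^sub>R norm u) (v /\<^sub>R norm v) = q u v / (norm u * norm v)"
      by (simp add: sb_scale_left[OF q] sb_scale_right[OF q] field_simps)
    ultimately have "\<bar>q u v\<bar> / (norm u * norm v) \<le> C" using p by simp
    then show ?thesis using p by (simp add: field_simps)
  qed
  show ?thesis
  proof
    show "\<exists>K. \<forall>a b. norm (q a b) \<le> norm a * norm b * K" using 2 by auto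
  qed (simp_all add: sb_simps[OF q])
qed

lemma LIMSEQ_imp_weakly_converges: "x \<longlonglongrightarrow> l \<Longrightarrow> weakly_converges x l"
  by (simp add: weakly_converges_def bounded_linear.tendsto)

text \<open>
An unbounded form would take values of modulus at least \<open>1\<close> along a sequence tending to \<open>0\<close> in norm,
hence weakly.
\<close>

lemma weakly_continuous_quadratic_bound:
  fixes b :: "'a::real_inner \<Rightarrow> 'a \<Rightarrow> real"
  assumes q: "symmetric_bilinear b" and w: "weakly_continuous b"
  obtains C where "\<forall>u. \<bar>b u u\<bar> \<le> C * (norm u)\<^sup>2"
proof (rule ccontr)
  assume "\<not> thesis"
  then have "\<exists>u. \<not> \<bar>b u u\<bar> \<le> (real (Suc k))\<^sup>2 * (norm u)\<^sup>2" for k using that by blast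
  then obtain u where u: "\<And>k. \<bar>b (u k) (u k)\<bar> > (real (Suc k))\<^sup>2 * (norm (u k))\<^sup>2"
    by (metis not_le)
  have u0: "norm (u k) \<noteq> 0" for k
    using u[of k] by (auto simp: sb_zero_left[OF q])
  define x where "x k = (1 / (real (Suc k) * norm (u k))) *\<^sub>R u k" for k
  have "norm (x k) = 1 / real (Suc k)" for k using u0[of k] by (simp add: x_def)
  then have "(\<lambda>k. norm (x k)) \<longlonglongrightarrow> 0" using LIMSEQ_Suc[OF lim_1_over_n] by simp
  then have x0: "x \<longlonglongrightarrow> 0" by (simp add: tendsto_norm_zero_iff)
  have "(\<lambda>k. b (x k) (x k)) \<longlonglongrightarrow> b 0 0"
    using w LIMSEQ_imp_weakly_converges[OF x0] by (auto simp: weakly_continuous_def)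
  then have "(\<lambda>k. \<bar>b (x k) (x k)\<bar>) \<longlonglongrightarrow> 0"
    by (simp add: sb_zero_left[OF q] tendsto_rabs_zero_iff)
  moreover have "1 \<le> \<bar>b (x k) (x k)\<bar>" for k
  proof -
    define s where "s = (real (Suc k) * norm (u k))\<^sup>2"
    have s: "0 < s" using u0[of k] by (simp add: s_def)
    have "b (x k) (x k) = b (u k) (u k) / s"
      by (simp add: x_def sb_scale_left[OF q] sb_scale_right[OF q] s_def power2_eq_square)
    then have "\<bar>b (x k) (x k)\<bar> = \<bar>b (u k) (u k)\<bar> / s" using s by simp
    moreover have "s \<le> \<bar>b (u k) (u k)\<bar>" using u[of k] by (simp add: s_def power_mult_distrib)
    ultimately show ?thesis using s by simp
  qed
  ultimately have "1 \<le> (0::real)" by (intro LIMSEQ_le_const) auto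
  then show False by simp
qed

text \<open>
Almost shortest points \<open>z k\<close> of \<open>D k\<close> form a Cauchy sequence: the midpoint of \<open>z j\<close> and \<open>z k\<close> lies in
the larger of the two sets, so it is not much shorter than either, and the parallelogram law
forces the points together. This is the only use of completeness; it replaces weak sequential
compactness of balls.
\<close>

lemma nested_closed_convex_nonempty:
  fixes D :: "nat \<Rightarrow> 'a::{real_inner, banach} set"
  assumes conv: "\<And>k. convex (D k)" and cl: "\<And>k. closed (D k)" and dec: "decseq D"
    and bd: "\<And>k. \<exists>x\<in>D k. norm x \<le> C"
  shows "\<exists>z. \<forall>k. z \<in> D k"
proof -
  define d where "d k = Inf (norm ` D k)" for k
  have ne: "norm ` D k \<noteq> {}" for k using bd[of k] by auto
  have bb: "bdd_below (norm ` D k)" for k by (rule bdd_belowI[of _ 0]) auto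
  have d_le: "d k \<le> norm x" if "x \<in> D k" for k x
    unfolding d_def using that bb by (intro cInf_lower) auto
  have d0: "0 \<le> d k" for k unfolding d_def using ne by (intro cInf_greatest) auto
  have dC: "d k \<le> C" for k using bd[of k] d_le by (meson order_trans)
  have "incseq d"
    unfolding incseq_def d_def using dec ne bb
    by (intro allI impI cInf_superset_mono) (auto simp: decseq_def)
  then obtain L where L: "d \<longlonglongrightarrow> L"
    using incseq_convergent[of d C] dC by blast
  have "\<exists>x\<in>D k. norm x < d k + 1 / real (Suc k)" for k
    using cInf_lessD[OF ne[of k], of "d k + 1 / real (Suc k)"] by (auto simp: d_def)
  then obtain z where z: "\<And>k. z k \<in> D k" "\<And>k. norm (z k) < d k + 1 / real (Suc k)" by metis
  have nz: "(\<lambda>k. norm (z k)) \<longlonglongrightarrow> L"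
  proof (rule tendsto_sandwich)
    show "d \<longlonglongrightarrow> L" by fact
    show "(\<lambda>k. d k + 1 / real (Suc k)) \<longlonglongrightarrow> L"
      using tendsto_add[OF L LIMSEQ_Suc[OF lim_1_over_n]] by simp
  qed (use d_le z in \<open>auto intro!: always_eventually less_imp_le\<close>)
  have "Cauchy z"
  proof (rule metric_CauchyI)
    fix \<epsilon> :: real assume "0 < \<epsilon>"
    have lim: "(\<lambda>k. (norm (z k))\<^sup>2) \<longlonglongrightarrow> L\<^sup>2" "(\<lambda>k. (d k)\<^sup>2) \<longlonglongrightarrow> L\<^sup>2"
      using nz L by (auto intro: tendsto_power)
    \<comment> \<open>The estimate below uses the two limits with total weight \<open>2 + 2 + 4 = 8\<close>.\<close>
    have e8: "0 < \<epsilon>\<^sup>2 / 8" using \<open>0 < \<epsilon>\<close> by simp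
    obtain N1 where N1: "\<forall>k\<ge>N1. \<bar>(norm (z k))\<^sup>2 - L\<^sup>2\<bar> < \<epsilon>\<^sup>2 / 8"
      using LIMSEQ_D[OF lim(1) e8] by auto
    obtain N2 where N2: "\<forall>k\<ge>N2. \<bar>(d k)\<^sup>2 - L\<^sup>2\<bar> < \<epsilon>\<^sup>2 / 8"
      using LIMSEQ_D[OF lim(2) e8] by auto
    have main: "dist (z j) (z k) < \<epsilon>" if jk: "max N1 N2 \<le> j" "j \<le> k" for j k
    proof -
      have "z k \<in> D j" using z(1) dec jk(2) by (auto simp: decseq_def)
      then have "(1/2) *\<^sub>R z j + (1/2) *\<^sub>R z k \<in> D j"
        using convexD[OF conv z(1), of "z k" j "1/2" "1/2"] by simp
      then have "d j \<le> norm ((1/2) *\<^sub>R (z j + z k))" using d_le by (simp add: scaleR_add_right)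
      then have "2 * d j \<le> norm (z j + z k)" by simp
      then have "(2 * d j)\<^sup>2 \<le> (norm (z j + z k))\<^sup>2" using d0[of j] by (intro power_mono) auto
      then have "(norm (z j - z k))\<^sup>2 \<le> 2 * (norm (z j))\<^sup>2 + 2 * (norm (z k))\<^sup>2 - 4 * (d j)\<^sup>2"
        using parallelogram[of "z j" "z k"] by (simp add: power_mult_distrib)
      also have "\<dots> < \<epsilon>\<^sup>2"
      proof -
        have "\<bar>(norm (z j))\<^sup>2 - L\<^sup>2\<bar> < \<epsilon>\<^sup>2 / 8" "\<bar>(norm (z k))\<^sup>2 - L\<^sup>2\<bar> < \<epsilon>\<^sup>2 / 8"
          "\<bar>(d j)\<^sup>2 - L\<^sup>2\<bar> < \<epsilon>\<^sup>2 / 8"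
          using N1 N2 jk by auto
        then show ?thesis by linarith
      qed
      finally have "(norm (z j - z k))\<^sup>2 < \<epsilon>\<^sup>2" .
      then show ?thesis using \<open>0 < \<epsilon>\<close> by (simp add: dist_norm power_less_imp_less_base)
    qed
    show "\<exists>M. \<forall>m\<ge>M. \<forall>n\<ge>M. dist (z m) (z n) < \<epsilon>"
    proof (intro exI[of _ "max N1 N2"] allI impI)
      fix j k assume "max N1 N2 \<le> j" "max N1 N2 \<le> k"
      then show "dist (z j) (z k) < \<epsilon>"
        using main[of j k] main[of k j] by (cases "j \<le> k") (auto simp: dist_commute)
    qed
  qed
  then obtain w where w: "z \<longlonglongrightarrow> w" using Cauchy_convergent_iff convergent_def by blast
  have "w \<in> D k" for k
  proof (rule Lim_in_closed_set[OF cl _ _ w])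
    show "\<forall>\<^sub>F j in sequentially. z j \<in> D k"
      using z(1) dec by (intro eventually_sequentiallyI[of k]) (auto simp: decseq_def)
  qed auto
  then show ?thesis by blast
qed

text \<open>
If some functional \<open>f\<close> stayed away from \<open>0\<close> along a subsequence, then, after a change of sign, the
nested closed convex sets \<open>{x \<in> H. q x x \<le> 1 / (k + 1) \<and> \<epsilon> \<le> f x}\<close> would have bounded points. A common
point \<open>z\<close> of them satisfies \<open>q z z = 0\<close> and \<open>f z \<noteq> 0\<close>, against definiteness on \<open>H\<close>.
\<close>

lemma weakly_null_of_form_null:
  fixes q :: "'a::{real_inner, banach} \<Rightarrow> 'a \<Rightarrow> real"
  assumes q: "symmetric_bilinear q" "bounded_bilinear q"
    and H: "subspace H" "closed H" "posdef_on q H"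
    and u: "\<And>k. u k \<in> H" "\<And>k. norm (u k) \<le> C" "(\<lambda>k. q (u k) (u k)) \<longlonglongrightarrow> 0"
  shows "weakly_converges u 0"
  unfolding weakly_converges_def
proof (intro allI impI)
  fix f :: "'a \<Rightarrow> real" assume f: "bounded_linear f"
  have psd: "0 \<le> q x x" if "x \<in> H" for x
    using H(3) that by (cases "x = 0") (auto simp: posdef_on_def sb_zero_left[OF q(1)] less_imp_le)
  show "(\<lambda>j. f (u j)) \<longlonglongrightarrow> f 0"
  proof (rule ccontr)
    assume "\<not> ?thesis"
    then have "\<not> (\<lambda>j. f (u j)) \<longlonglongrightarrow> 0" by (simp add: linear_0[OF bounded_linear.linear[OF f]])
    then obtain \<epsilon> where \<epsilon>: "0 < \<epsilon>" "\<And>N. \<exists>k\<ge>N. \<epsilon> \<le> \<bar>f (u k)\<bar>"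
      by (auto simp: lim_sequentially not_less)
    define D where "D j = {x \<in> H. q x x \<le> 1 / real (Suc j) \<and> \<epsilon> \<le> f x}" for j :: nat
    have "\<exists>z. \<forall>k. z \<in> D k"
    proof (rule nested_closed_convex_nonempty)
      fix j
      show "convex (D j)"
      proof (rule convexI)
        fix x y and s t :: real
        assume xy: "x \<in> D j" "y \<in> D j" and st: "0 \<le> s" "0 \<le> t" "s + t = 1"
        have s: "s = 1 - t" using st by simp
        have xyH: "x \<in> H" "y \<in> H" using xy by (auto simp: D_def)
        \<comment> \<open>A nonnegative quadratic form is convex.\<close>
        have "q (s *\<^sub>R x + t *\<^sub>R y) (s *\<^sub>R x + t *\<^sub>R y) = s * q x x + t * q y y - s * t * q (x - y) (x - y)"
          unfolding s using sb_sym[OF q(1), of y x] by (simp add: sb_simps[OF q(1)] algebra_simps)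
        also have "\<dots> \<le> s * q x x + t * q y y"
          using st psd[of "x - y"] xyH H(1) by (simp add: subspace_diff)
        also have "\<dots> \<le> s * (1 / real (Suc j)) + t * (1 / real (Suc j))"
          using xy st by (intro add_mono mult_left_mono) (auto simp: D_def)
        also have "\<dots> = 1 / real (Suc j)" using st(3) by (simp only: distrib_right[symmetric] mult_1_left)
        finally have 1: "q (s *\<^sub>R x + t *\<^sub>R y) (s *\<^sub>R x + t *\<^sub>R y) \<le> 1 / real (Suc j)" .
        have "\<epsilon> = s * \<epsilon> + t * \<epsilon>" using st(3) by (simp only: distrib_right[symmetric] mult_1_left)
        also have "\<dots> \<le> s * f x + t * f y"
          using xy st by (intro add_mono mult_left_mono) (auto simp: D_def)
        also have "\<dots> = f (s *\<^sub>R x + t *\<^sub>R y)"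
          using bounded_linear.linear[OF f] by (simp add: linear_add linear_scale)
        finally have 2: "\<epsilon> \<le> f (s *\<^sub>R x + t *\<^sub>R y)" .
        show "s *\<^sub>R x + t *\<^sub>R y \<in> D j"
          using 1 2 xyH H(1) by (simp add: D_def subspace_add subspace_scale)
      qed
      have cq: "continuous_on UNIV (\<lambda>x. q x x)"
        using bounded_bilinear.continuous_on[OF q(2) continuous_on_id continuous_on_id] by simp
      have cf: "continuous_on UNIV f" using f by (simp add: linear_continuous_on)
      have "D j = H \<inter> {x. q x x \<le> 1 / real (Suc j)} \<inter> {x. \<epsilon> \<le> f x}" by (auto simp: D_def)
      then show "closed (D j)"
        using H(2) closed_Collect_le[OF cq continuous_on_const] closed_Collect_le[OF continuous_on_const cf]
        by (simp add: closed_Int)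
      have "\<exists>N. \<forall>k\<ge>N. q (u k) (u k) \<le> 1 / real (Suc j)"
      proof -
        have "0 < 1 / real (Suc j)" by simp
        from LIMSEQ_D[OF u(3) this] show ?thesis by (auto simp: abs_less_iff intro: less_imp_le)
      qed
      then obtain N where N: "\<forall>k\<ge>N. q (u k) (u k) \<le> 1 / real (Suc j)" by blast
      obtain k where k: "N \<le> k" "\<epsilon> \<le> \<bar>f (u k)\<bar>" using \<epsilon>(2) by blast
      define x where "x = (if 0 \<le> f (u k) then u k else - u k)"
      have "x \<in> D j" "norm x \<le> C"
        using N k u(1,2)[of k] H(1) linear_neg[OF bounded_linear.linear[OF f], of "u k"]
          sb_scale_left[OF q(1), of "-1" "u k"] sb_scale_right[OF q(1), of _ "-1" "u k"]
        by (auto simp: x_def D_def subspace_neg)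
      then show "\<exists>x\<in>D j. norm x \<le> C" by blast
    next
      show "decseq D"
      proof (rule decseq_SucI)
        fix n
        have "1 / real (Suc (Suc n)) \<le> 1 / real (Suc n)" by (simp add: field_simps)
        then show "D (Suc n) \<subseteq> D n" unfolding D_def by (auto simp del: of_nat_Suc)
      qed
    qed
    then obtain z where z: "\<And>k. z \<in> D k" by blast
    have "(\<lambda>k. 1 / real (Suc k)) \<longlonglongrightarrow> 0" using LIMSEQ_Suc[OF lim_1_over_n] by simp
    then have "q z z \<le> 0" using z by (intro LIMSEQ_le_const) (auto simp: D_def)
    then have "z = 0" using z[of 0] H(3) by (force simp: posdef_on_def D_def)
    then have "f z = 0" using linear_0[OF bounded_linear.linear[OF f]] by simp
    then show False using z[of 0] \<epsilon>(1) by (simp add: D_def)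
  qed
qed

text \<open>
By Bessel's inequality, proved by applying \<open>f\<close> to \<open>\<Sum>k<N. f (e k) *\<^sub>R e k\<close>.
\<close>

lemma orthonormal_weakly_null:
  fixes e :: "nat \<Rightarrow> 'a::real_inner"
  assumes n: "\<And>k. norm (e k) = 1" and o: "\<And>j k. j \<noteq> k \<Longrightarrow> inner (e j) (e k) = 0"
  shows "weakly_converges e 0"
  unfolding weakly_converges_def
proof (intro allI impI)
  fix f :: "'a \<Rightarrow> real" assume f: "bounded_linear f"
  note lin = bounded_linear.linear[OF f]
  obtain K where K: "0 \<le> K" "\<And>x. \<bar>f x\<bar> \<le> norm x * K"
    using bounded_linear.nonneg_bounded[OF f] by auto
  have bessel: "(\<Sum>k<N. (f (e k))\<^sup>2) \<le> K\<^sup>2" for N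
  proof -
    define s where "s = (\<Sum>k<N. (f (e k))\<^sup>2)"
    define v where "v = (\<Sum>k<N. f (e k) *\<^sub>R e k)"
    have s0: "0 \<le> s" unfolding s_def by (simp add: sum_nonneg)
    have "f v = s" by (simp add: v_def s_def linear_sum[OF lin] linear_scale[OF lin] power2_eq_square)
    have ev: "inner (e j) v = f (e j)" if j: "j < N" for j
    proof -
      have "inner (e j) v = (\<Sum>k<N. if k = j then f (e j) else 0)"
        unfolding v_def inner_sum_right using o n
        by (intro sum.cong refl) (auto simp: dot_square_norm)
      then show ?thesis using j by simp
    qed
    have "inner v v = (\<Sum>j<N. f (e j) * inner (e j) v)"
      by (subst (1) v_def) (simp add: inner_sum_left)
    also have "\<dots> = (\<Sum>j<N. f (e j) * f (e j))" using ev by simp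
    finally have nv: "(norm v)\<^sup>2 = s" by (simp add: s_def power2_eq_square[of "f _"] dot_square_norm[symmetric])
    have "s\<^sup>2 = \<bar>f v\<bar>\<^sup>2" using \<open>f v = s\<close> by simp
    also have "\<dots> \<le> (norm v * K)\<^sup>2" using K by (intro power_mono) auto
    also have "\<dots> = s * K\<^sup>2" by (simp add: power_mult_distrib nv)
    finally have "s * s \<le> s * K\<^sup>2" by (simp add: power2_eq_square)
    then have "s \<le> K\<^sup>2" using s0 by (cases "s = 0") (auto simp: mult_le_cancel_left)
    then show ?thesis by (simp add: s_def)
  qed
  have "summable (\<lambda>k. (f (e k))\<^sup>2)"
  proof (rule bounded_imp_summable[where B = "K\<^sup>2"])
    show "(\<Sum>k\<le>n. (f (e k))\<^sup>2) \<le> K\<^sup>2" for n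
      using bessel[of "Suc n"] by (simp only: lessThan_Suc_atMost)
  qed simp
  then have "(\<lambda>k. (f (e k))\<^sup>2) \<longlonglongrightarrow> 0" by (rule summable_LIMSEQ_zero)
  then have "(\<lambda>k. f (e k)) \<longlonglongrightarrow> 0" by simp
  then show "(\<lambda>k. f (e k)) \<longlonglongrightarrow> f 0" by (simp add: linear_0[OF lin])
qed

lemma infinite_dim_orthonormal_sequence:
  fixes N :: "'a::real_inner set"
  assumes N: "subspace N" "\<not> fin_dim N"
  obtains e :: "nat \<Rightarrow> 'a" where "\<forall>k. e k \<in> N" "\<forall>k. norm (e k) = 1" "\<forall>j k. j \<noteq> k \<longrightarrow> inner (e j) (e k) = 0"
proof -
  define P where "P f n r \<longleftrightarrow> r \<in> N \<and> norm r = 1 \<and> (\<forall>k<n. inner r (f k) = 0)"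
    for f :: "nat \<Rightarrow> 'a" and n r
  have "\<exists>e. \<forall>n. P e n (e n)"
  proof (rule dependent_wf_choice[OF wf_less_than])
    show "P f n r = P g n r" if "\<And>z. (z, n) \<in> less_than \<Longrightarrow> f z = g z" for f g n r
      using that by (auto simp: P_def)
    fix n :: nat and f
    assume "\<And>y. (y, n) \<in> less_than \<Longrightarrow> P f y (f y)"
    then have f: "f k \<in> N" if "k < n" for k using that by (auto simp: P_def)
    let ?W = "span (f ` {..<n})"
    have W: "fin_dim ?W" by (rule fin_dim_span) simp
    have WN: "?W \<subseteq> N" using f N(1) by (intro span_minimal) auto
    have "\<not> N \<subseteq> ?W" using W N(2) fin_dim_subset by blast
    then obtain x where x: "x \<in> N" "x \<notin> ?W" by blast
    have nd: "nondeg_on inner ?W" by (rule posdef_imp_nondeg) (simp add: posdef_on_def)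
    obtain w where w: "w \<in> ?W" "\<forall>y\<in>?W. inner y (x - w) = 0"
      by (rule nondeg_projection[OF symmetric_bilinear_inner W subspace_span nd, of x])
    define y where "y = x - w"
    have y: "y \<in> N" "y \<noteq> 0" using x w WN N(1) by (auto simp: y_def subspace_diff)
    have "P f n (y /\<^sub>R norm y)"
      unfolding P_def using y N(1) w(2)
      by (auto simp: subspace_scale y_def[symmetric] inner_commute span_base)
    then show "\<exists>r. P f n r" ..
  qed
  then obtain e where e: "\<And>n. P e n (e n)" by blast
  have "inner (e j) (e k) = 0" if "j \<noteq> k" for j k
  proof -
    have "j < k \<or> k < j" using that by auto
    then show ?thesis using e[of j] e[of k] by (auto simp: P_def inner_commute)
  qed
  then show ?thesis using e by (intro that[of e]) (auto simp: P_def)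
qed

section \<open>Eigenvalues and nonpositive subspaces\<close>

text \<open>
The form under study is \<open>a - r\<close> with a weakly continuous perturbation \<open>r\<close>; in the application
\<open>r = t * b\<close>.
\<close>

locale weakly_perturbed_form =
  fixes a r m :: "'a::{real_inner, banach} \<Rightarrow> 'a \<Rightarrow> real"
  assumes a: "symmetric_bilinear a" and r: "symmetric_bilinear r" and m: "symmetric_bilinear m"
    and coercive: "continuous_coercive a"
    and r_weak: "weakly_continuous r" and m_weak: "weakly_continuous m"
    and m_pos: "\<And>u. u \<noteq> 0 \<Longrightarrow> 0 < m u u"
begin

abbreviation c :: "'a \<Rightarrow> 'a \<Rightarrow> real" where
  "c \<equiv> \<lambda>u v. a u v - r u v"

lemma c: "symmetric_bilinear c"
  using sb_diff_scale[OF a r, of 1] by simp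

lemma c_shift: "symmetric_bilinear (\<lambda>u v. c u v - t * m u v)"
  by (rule sb_diff_scale[OF c m])

lemma bounded_a: "bounded_bilinear a"
proof -
  obtain k1 k2 where k: "0 < k1" "\<And>u. k1 * (norm u)\<^sup>2 \<le> a u u \<and> a u u \<le> k2 * (norm u)\<^sup>2"
    using coercive by (auto simp: continuous_coercive_def)
  have "\<bar>a u u\<bar> \<le> k2 * (norm u)\<^sup>2" for u
  proof -
    have "0 \<le> k1 * (norm u)\<^sup>2" using k(1) by simp
    then show ?thesis using k(2)[of u] by linarith
  qed
  then show ?thesis by (rule bounded_bilinear_of_quadratic_bound[OF a])
qed

lemma bounded_r: "bounded_bilinear r"
  by (rule weakly_continuous_quadratic_bound[OF r r_weak])
     (rule bounded_bilinear_of_quadratic_bound[OF r], blast)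

lemma bounded_m: "bounded_bilinear m"
  by (rule weakly_continuous_quadratic_bound[OF m m_weak])
     (rule bounded_bilinear_of_quadratic_bound[OF m], blast)

lemma bounded_c_shift: "bounded_bilinear (\<lambda>u v. c u v - t * m u v)"
proof -
  obtain Ka where Ka: "\<And>u v. norm (a u v) \<le> norm u * norm v * Ka"
    using bounded_bilinear.bounded[OF bounded_a] by blast
  obtain Kr where Kr: "\<And>u v. norm (r u v) \<le> norm u * norm v * Kr"
    using bounded_bilinear.bounded[OF bounded_r] by blast
  obtain Km where Km: "\<And>u v. norm (m u v) \<le> norm u * norm v * Km"
    using bounded_bilinear.bounded[OF bounded_m] by blast
  show ?thesis
  proof (rule bounded_bilinear_of_quadratic_bound[OF c_shift])
    fix u
    have "\<bar>c u u - t * m u u\<bar> \<le> \<bar>a u u\<bar> + \<bar>r u u\<bar> + \<bar>t\<bar> * \<bar>m u u\<bar>"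
      using abs_triangle_ineq4[of "a u u - r u u" "t * m u u"] abs_triangle_ineq4[of "a u u" "r u u"]
      by (simp add: abs_mult)
    also have "\<dots> \<le> norm u * norm u * Ka + norm u * norm u * Kr + \<bar>t\<bar> * (norm u * norm u * Km)"
      using Ka[of u u] Kr[of u u] Km[of u u] by (intro add_mono mult_left_mono) auto
    also have "\<dots> = (Ka + Kr + \<bar>t\<bar> * Km) * (norm u)\<^sup>2"
      by (simp add: algebra_simps power2_eq_square)
    finally show "\<bar>c u u - t * m u u\<bar> \<le> (Ka + Kr + \<bar>t\<bar> * Km) * (norm u)\<^sup>2" .
  qed
qed

lemma posdef_m: "posdef_on m S"
  using m_pos by (auto simp: posdef_on_def)

text \<open>
Along a weakly null sequence \<open>r\<close> and \<open>m\<close> tend to \<open>0\<close> while coercivity keeps \<open>a\<close> away from \<open>0\<close>. The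
compactness arguments below all end in this contradiction.
\<close>

lemma no_weakly_null_unit_sequence:
  assumes u: "\<And>k. norm (u k) = 1" "weakly_converges u 0"
    and le: "\<And>k. a (u k) (u k) \<le> s k + r (u k) (u k) + t * m (u k) (u k)"
    and s: "s \<longlonglongrightarrow> 0"
  shows False
proof -
  obtain k1 k2 where k: "0 < k1" "\<And>u. k1 * (norm u)\<^sup>2 \<le> a u u \<and> a u u \<le> k2 * (norm u)\<^sup>2"
    using coercive by (auto simp: continuous_coercive_def)
  have lr: "(\<lambda>k. r (u k) (u k)) \<longlonglongrightarrow> r 0 0" using r_weak u(2) unfolding weakly_continuous_def by blast
  have lm: "(\<lambda>k. m (u k) (u k)) \<longlonglongrightarrow> m 0 0" using m_weak u(2) unfolding weakly_continuous_def by blast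
  have lim: "(\<lambda>k. s k + r (u k) (u k) + t * m (u k) (u k)) \<longlonglongrightarrow> 0 + r 0 0 + t * m 0 0"
    by (intro tendsto_intros s lr lm)
  have "k1 \<le> s k + r (u k) (u k) + t * m (u k) (u k)" for k
    using k(2)[of "u k"] u(1)[of k] le[of k] by simp
  then have "k1 \<le> 0 + r 0 0 + t * m 0 0" by (intro LIMSEQ_le_const[OF lim]) auto
  then show False using k(1) by (simp add: sb_zero_left[OF r] sb_zero_left[OF m])
qed

lemma sb_normalize:
  assumes "symmetric_bilinear q"
  shows "q (x /\<^sub>R norm x) (x /\<^sub>R norm x) = q x x / (norm x)\<^sup>2"
  by (simp add: sb_scale_left[OF assms] sb_scale_right[OF assms] power2_eq_square divide_inverse)

text \<open>
Garding's inequality in its weakest form. Unit vectors with \<open>c u u < - k * m u u\<close> would have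
\<open>m u u\<close> of order \<open>1 / k\<close>, so they would be weakly null.
\<close>

lemma garding: "\<exists>t. \<forall>u. 0 \<le> c u u - t * m u u"
proof (rule ccontr)
  assume "\<not> ?thesis"
  then have "\<exists>u. c u u + real (Suc k) * m u u < 0" for k
    by (metis diff_minus_eq_add mult_minus_left not_le)
  then obtain x where x: "\<And>k. c (x k) (x k) + real (Suc k) * m (x k) (x k) < 0" by metis
  have x0: "x k \<noteq> 0" for k using x[of k] by (auto simp: sb_zero_left[OF a] sb_zero_left[OF r] sb_zero_left[OF m])
  define u where "u k = x k /\<^sub>R norm (x k)" for k
  have nu: "norm (u k) = 1" for k using x0 by (simp add: u_def)
  have u: "a (u k) (u k) + real (Suc k) * m (u k) (u k) < r (u k) (u k)" for k
  proof -
    have "(a (x k) (x k) + real (Suc k) * m (x k) (x k)) / (norm (x k))\<^sup>2 < r (x k) (x k) / (norm (x k))\<^sup>2"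
      using x[of k] x0[of k] by (intro divide_strict_right_mono) auto
    then show ?thesis
      unfolding u_def sb_normalize[OF a] sb_normalize[OF r] sb_normalize[OF m]
      by (simp add: add_divide_distrib)
  qed
  obtain K where K: "\<And>u v. norm (r u v) \<le> norm u * norm v * K"
    using bounded_bilinear.bounded[OF bounded_r] by blast
  obtain k1 k2 where k: "0 < k1" "\<And>u. k1 * (norm u)\<^sup>2 \<le> a u u \<and> a u u \<le> k2 * (norm u)\<^sup>2"
    using coercive by (auto simp: continuous_coercive_def)
  have a0: "0 \<le> a (u k) (u k)" for k using k(1) k(2)[of "u k"] nu[of k] by simp
  have m0: "0 \<le> m (u k) (u k)" for k using m_pos[of "u k"] nu[of k] by (cases "u k = 0") auto
  have "m (u k) (u k) \<le> K * (1 / real (Suc k))" for k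
  proof -
    have "real (Suc k) * m (u k) (u k) \<le> K" using u[of k] a0[of k] K[of "u k" "u k"] nu[of k] by simp
    then show ?thesis by (simp add: field_simps del: of_nat_Suc)
  qed
  moreover have "(\<lambda>k. K * (1 / real (Suc k))) \<longlonglongrightarrow> K * 0"
    by (intro tendsto_mult tendsto_const) (use LIMSEQ_Suc[OF lim_1_over_n] in simp)
  ultimately have "(\<lambda>k. m (u k) (u k)) \<longlonglongrightarrow> 0"
    using tendsto_sandwich[of "\<lambda>_. 0" "\<lambda>k. m (u k) (u k)" sequentially "\<lambda>k. K * (1 / real (Suc k))" 0] m0
    by simp
  then have "weakly_converges u 0"
    using nu by (intro weakly_null_of_form_null[OF m bounded_m subspace_UNIV closed_UNIV posdef_m, of u 1]) auto
  then show False
  proof (rule no_weakly_null_unit_sequence[OF nu, where s = "\<lambda>_. 0" and t = 0])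
    show "a (u k) (u k) \<le> 0 + r (u k) (u k) + 0 * m (u k) (u k)" for k
    proof -
      have "0 \<le> real (Suc k) * m (u k) (u k)" using m0 by (intro mult_nonneg_nonneg) auto
      then show ?thesis using u[of k] by linarith
    qed
  qed simp
qed

text \<open>
The infimum \<open>\<nu>\<close> of the Rayleigh quotient of \<open>c\<close> by \<open>m\<close> on \<open>H\<close> is attained. If it were not,
\<open>c - \<nu> m\<close> would be positive definite on \<open>H\<close> but not bounded below by any positive multiple of \<open>m\<close>;
unit vectors witnessing this are weakly null, which is impossible. A minimizer lies in the
radical of the nonnegative form \<open>c - \<nu> m\<close> on \<open>H\<close>.
\<close>

lemma exists_lowest_critical_point:
  assumes H: "subspace H" "closed H" and u0: "u0 \<in> H" "u0 \<noteq> 0" "c u0 u0 \<le> \<gamma> * m u0 u0"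
  shows "\<exists>\<nu>\<le>\<gamma>. \<exists>z\<in>H. z \<noteq> 0 \<and> (\<forall>v\<in>H. c z v = \<nu> * m z v)"
proof -
  define G where "G = {t. \<forall>u\<in>H. 0 \<le> c u u - t * m u u}"
  have Gne: "G \<noteq> {}" using garding by (auto simp: G_def)
  have Gb: "t \<le> \<gamma>" if "t \<in> G" for t
  proof -
    have "t * m u0 u0 \<le> \<gamma> * m u0 u0" using that u0 by (force simp: G_def)
    then show ?thesis using m_pos[OF u0(2)] by simp
  qed
  then have bdd: "bdd_above G" by (auto simp: bdd_above_def)
  define \<nu> where "\<nu> = Sup G"
  have \<nu>_le: "\<nu> \<le> \<gamma>" unfolding \<nu>_def using Gne Gb by (rule cSup_least)
  let ?q = "\<lambda>u v. c u v - \<nu> * m u v"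
  note q = c_shift[of \<nu>]
  have psd: "0 \<le> ?q u u" if u: "u \<in> H" for u
  proof (cases "u = 0")
    case True
    then show ?thesis by (simp add: sb_zero_left[OF a] sb_zero_left[OF r] sb_zero_left[OF m])
  next
    case False
    have "t \<le> c u u / m u u" if "t \<in> G" for t
      using that u m_pos[OF False] by (auto simp: G_def field_simps)
    then have "\<nu> \<le> c u u / m u u" unfolding \<nu>_def by (intro cSup_least Gne)
    then show ?thesis using m_pos[OF False] by (simp add: field_simps)
  qed
  have "\<exists>z\<in>H. z \<noteq> 0 \<and> ?q z z = 0"
  proof (rule ccontr)
    assume "\<not> ?thesis"
    then have pd: "posdef_on ?q H" using psd unfolding posdef_on_def by (metis less_eq_real_def)
    have "\<exists>u\<in>H. ?q u u < (1 / real (Suc k)) * m u u" for k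
    proof (rule ccontr)
      assume "\<not> ?thesis"
      then have "\<nu> + 1 / real (Suc k) \<in> G" by (force simp: G_def algebra_simps)
      then have "\<nu> + 1 / real (Suc k) \<le> \<nu>" unfolding \<nu>_def by (rule cSup_upper[OF _ bdd])
      then show False by simp
    qed
    then obtain x where x: "\<And>k. x k \<in> H" "\<And>k. ?q (x k) (x k) < (1 / real (Suc k)) * m (x k) (x k)" by metis
    have x0: "x k \<noteq> 0" for k using x(2)[of k] by (auto simp: sb_zero_left[OF a] sb_zero_left[OF r] sb_zero_left[OF m])
    define u where "u k = x k /\<^sub>R norm (x k)" for k
    have nu: "norm (u k) = 1" for k using x0 by (simp add: u_def)
    have uH: "u k \<in> H" for k using x(1) H(1) by (simp add: u_def subspace_scale)
    have uq: "?q (u k) (u k) \<le> (1 / real (Suc k)) * m (u k) (u k)" for k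
    proof -
      have "?q (x k) (x k) / (norm (x k))\<^sup>2 \<le> ((1 / real (Suc k)) * m (x k) (x k)) / (norm (x k))\<^sup>2"
        using x(2)[of k] by (intro divide_right_mono) auto
      then show ?thesis
        unfolding u_def sb_normalize[OF q] unfolding sb_normalize[OF m] by simp
    qed
    obtain K where K: "\<And>u v. norm (m u v) \<le> norm u * norm v * K"
      using bounded_bilinear.bounded[OF bounded_m] by blast
    have uq': "?q (u k) (u k) \<le> (1 / real (Suc k)) * K" for k
    proof -
      have "m (u k) (u k) \<le> K" using K[of "u k" "u k"] nu[of k] by simp
      then have "(1 / real (Suc k)) * m (u k) (u k) \<le> (1 / real (Suc k)) * K" by (intro mult_left_mono) auto
      then show ?thesis using uq[of k] by linarith
    qed
    have limK: "(\<lambda>k. (1 / real (Suc k)) * K) \<longlonglongrightarrow> 0"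
      using tendsto_mult[OF LIMSEQ_Suc[OF lim_1_over_n] tendsto_const[of K]] by simp
    have lim: "(\<lambda>k. ?q (u k) (u k)) \<longlonglongrightarrow> 0"
      by (rule tendsto_sandwich[OF _ _ tendsto_const limK]) (use psd[OF uH] uq' in auto)
    have "weakly_converges u 0"
      using nu lim uH by (intro weakly_null_of_form_null[OF q bounded_c_shift H pd, of u 1]) auto
    then show False
      by (rule no_weakly_null_unit_sequence[OF nu, where s = "\<lambda>k. ?q (u k) (u k)" and t = \<nu>])
         (use lim in auto)
  qed
  then obtain z where z: "z \<in> H" "z \<noteq> 0" "?q z z = 0" by blast
  have "c z v = \<nu> * m z v" if "v \<in> H" for v
    using psd_zero_imp_radical[OF q H(1) psd z(1,3) that] by simp
  then show ?thesis using \<nu>_le z by blast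
qed

text \<open>
An orthonormal sequence in \<open>N\<close> would be weakly null.
\<close>

lemma nonpos_imp_fin_dim:
  assumes N: "subspace N" "\<And>x. x \<in> N \<Longrightarrow> c x x \<le> \<gamma> * m x x"
  shows "fin_dim N"
proof (rule ccontr)
  assume "\<not> fin_dim N"
  then obtain e :: "nat \<Rightarrow> 'a" where e: "\<forall>k. e k \<in> N" "\<forall>k. norm (e k) = 1"
    "\<forall>j k. j \<noteq> k \<longrightarrow> inner (e j) (e k) = 0"
    by (rule infinite_dim_orthonormal_sequence[OF N(1)])
  have "weakly_converges e 0" using e by (intro orthonormal_weakly_null) auto
  then show False
  proof (rule no_weakly_null_unit_sequence[rotated, where s = "\<lambda>_. 0" and t = \<gamma>])
    show "a (e k) (e k) \<le> 0 + r (e k) (e k) + \<gamma> * m (e k) (e k)" for k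
      using N(2)[of "e k"] e(1) by simp
  qed (use e in auto)
qed

abbreviation eigspace :: "real \<Rightarrow> 'a set" where "eigspace \<equiv> form_eigenspace c m"

definition eigsum :: "real set \<Rightarrow> 'a set" where
  "eigsum I = span (\<Union>\<nu>\<in>I. eigspace \<nu>)"

lemma subspace_eigspace: "subspace (eigspace \<nu>)"
proof -
  have "eigspace \<nu> = {u \<in> UNIV. \<forall>v\<in>UNIV. c v u - \<nu> * m v u = 0}"
    using sb_sym[OF a] sb_sym[OF r] sb_sym[OF m] by (simp add: form_eigenspace_def)
  then show ?thesis using perp_subspace[OF c_shift[of \<nu>] subspace_UNIV, of UNIV] by simp
qed

lemma eigspace_eq: "u \<in> eigspace \<nu> \<Longrightarrow> c u v = \<nu> * m u v"
  by (simp add: form_eigenspace_def)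

lemma spectrum_iff: "\<nu> \<in> form_spectrum c m \<longleftrightarrow> (\<exists>u\<in>eigspace \<nu>. u \<noteq> 0)"
  by (auto simp: form_spectrum_def form_eigenspace_def)

lemma eigspace_orthogonal:
  assumes "u \<in> eigspace \<mu>" "v \<in> eigspace \<nu>" "\<mu> \<noteq> \<nu>"
  shows "m u v = 0"
proof -
  have "\<mu> * m u v = \<nu> * m u v"
    using eigspace_eq[OF assms(1), of v] eigspace_eq[OF assms(2), of u] sb_sym[OF c, of u v] sb_sym[OF m, of u v]
    by metis
  then show ?thesis using assms(3) by simp
qed

lemma eigsum_orthogonal:
  assumes u: "u \<in> eigspace \<nu>" and v: "v \<in> eigsum I" and "\<nu> \<notin> I"
  shows "m u v = 0" "c u v = 0"
proof -
  have "eigsum I \<subseteq> {v. m u v = 0}"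
    unfolding eigsum_def
  proof (rule span_minimal)
    show "(\<Union>\<nu>\<in>I. eigspace \<nu>) \<subseteq> {v. m u v = 0}" using eigspace_orthogonal[OF u] assms(3) by force
    show "subspace {v. m u v = 0}" using m by (auto simp: subspace_def sb_simps)
  qed
  then show "m u v = 0" using v by auto
  then show "c u v = 0" using eigspace_eq[OF u, of v] by simp
qed

lemma eigsum_insert:
  "eigsum (insert \<nu> I) = {x + y | x y. x \<in> eigspace \<nu> \<and> y \<in> eigsum I}"
proof -
  have "eigsum (insert \<nu> I) = span (eigspace \<nu> \<union> (\<Union>\<nu>\<in>I. eigspace \<nu>))"
    by (simp add: eigsum_def)
  then show ?thesis
    using subspace_eigspace[of \<nu>] by (simp add: span_Un eigsum_def span_eq_iff[THEN iffD2])
qed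

lemma eigsum_mono: "I \<subseteq> J \<Longrightarrow> eigsum I \<subseteq> eigsum J"
  unfolding eigsum_def by (intro span_mono UN_mono) auto

text \<open>
Eigenspaces of different eigenvalues are orthogonal for both \<open>c\<close> and \<open>m\<close>, so the inequality may be
checked on each of them.
\<close>

lemma eigsum_finite_nonpos:
  assumes "finite I" "I \<subseteq> {..\<gamma>}" "x \<in> eigsum I"
  shows "c x x \<le> \<gamma> * m x x"
  using assms
proof (induction I arbitrary: x rule: finite_induct)
  case empty
  then show ?case by (simp add: eigsum_def sb_zero_left[OF a] sb_zero_left[OF r] sb_zero_left[OF m])
next
  case (insert \<nu> I)
  obtain u v where uv: "u \<in> eigspace \<nu>" "v \<in> eigsum I" "x = u + v"
    using insert(5) unfolding eigsum_insert by blast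
  note o = eigsum_orthogonal[OF uv(1,2) insert(2)]
  have "c x x = c u u + c v v" unfolding uv(3) sb_add_self[OF c] using o(2) by simp
  moreover have "m x x = m u u + m v v" unfolding uv(3) sb_add_self[OF m] using o(1) by simp
  moreover have "c u u \<le> \<gamma> * m u u"
  proof -
    have "0 \<le> m u u" using m_pos[of u] by (cases "u = 0") (auto simp: sb_zero_left[OF m])
    then have "\<nu> * m u u \<le> \<gamma> * m u u" using insert(4) by (intro mult_right_mono) auto
    then show ?thesis using eigspace_eq[OF uv(1), of u] by simp
  qed
  moreover have "c v v \<le> \<gamma> * m v v" using insert(3)[OF _ uv(2)] insert(4) by auto
  ultimately show ?case by (simp add: distrib_left)
qed

lemma eigsum_finite_support:
  assumes "x \<in> eigsum J"
  obtains I where "finite I" "I \<subseteq> J" "x \<in> eigsum I"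
proof -
  obtain T where T: "finite T" "T \<subseteq> (\<Union>\<nu>\<in>J. eigspace \<nu>)" "x \<in> span T"
    using assms unfolding eigsum_def by (auto simp: span_explicit)
  then have "\<forall>y\<in>T. \<exists>\<nu>\<in>J. y \<in> eigspace \<nu>" by blast
  then obtain g where g: "\<And>y. y \<in> T \<Longrightarrow> g y \<in> J \<and> y \<in> eigspace (g y)" by metis
  have "span T \<subseteq> eigsum (g ` T)" unfolding eigsum_def using g by (intro span_mono) blast
  then show ?thesis using that[of "g ` T"] T(1,3) g by blast
qed

lemma eigsum_nonpos: "x \<in> eigsum {..\<gamma>} \<Longrightarrow> c x x \<le> \<gamma> * m x x"
  using eigsum_finite_support[of x "{..\<gamma>}"] eigsum_finite_nonpos by metis

lemma subspace_eigsum: "subspace (eigsum I)"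
  by (simp add: eigsum_def)

text \<open>
The eigenvectors with eigenvalue at most \<open>\<gamma>\<close> span a subspace on which \<open>c \<le> \<gamma> m\<close>.
\<close>

lemma fin_dim_eigsum:
  assumes "I \<subseteq> {..\<gamma>}"
  shows "fin_dim (eigsum I)"
  using nonpos_imp_fin_dim[OF subspace_eigsum eigsum_nonpos] eigsum_mono[OF assms]
  by (rule fin_dim_subset)

lemmas fin_dim_eigsum_atMost = fin_dim_eigsum[OF order_refl]

lemma eigspace_subset_eigsum: "\<nu> \<in> I \<Longrightarrow> eigspace \<nu> \<subseteq> eigsum I"
  unfolding eigsum_def by (meson UN_upper span_superset subset_trans)

lemma dim_eigsum:
  assumes "finite I" "I \<subseteq> {..\<gamma>}"
  shows "dim (eigsum I) = (\<Sum>\<nu>\<in>I. dim (eigspace \<nu>))"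
  using assms
proof (induction I rule: finite_induct)
  case empty
  have "dim {0::'a} = 0" using dim_le_card[of "{0}" "{}"] by simp
  then show ?case by (simp add: eigsum_def)
next
  case (insert \<nu> I)
  have f: "fin_dim (eigsum (insert \<nu> I))" by (rule fin_dim_eigsum[OF insert(4)])
  have sub: "eigspace \<nu> \<subseteq> eigsum (insert \<nu> I)" "eigsum I \<subseteq> eigsum (insert \<nu> I)"
    by (rule eigspace_subset_eigsum, simp, rule eigsum_mono, blast)
  have triv: "eigspace \<nu> \<inter> eigsum I \<subseteq> {0}"
  proof
    fix x assume x: "x \<in> eigspace \<nu> \<inter> eigsum I"
    then have "m x x = 0" using eigsum_orthogonal(1)[of x \<nu> x I] insert(2) by blast
    then show "x \<in> {0}" using m_pos[of x] by force
  qed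
  have "dim (eigspace \<nu>) + dim (eigsum I) \<le> dim (eigsum (insert \<nu> I))"
    by (rule dim_add_le_of_trivial_meet[OF f sub subspace_eigspace subspace_eigsum triv])
  moreover have "dim (eigsum (insert \<nu> I)) \<le> dim (eigspace \<nu>) + dim (eigsum I)"
  proof -
    obtain A where A: "finite A" "A \<subseteq> eigspace \<nu>" "independent A" "span A = eigspace \<nu>" "card A = dim (eigspace \<nu>)"
      by (rule fin_dim_basis[OF fin_dim_subset[OF f sub(1)] subspace_eigspace])
    obtain B where B: "finite B" "B \<subseteq> eigsum I" "independent B" "span B = eigsum I" "card B = dim (eigsum I)"
      by (rule fin_dim_basis[OF fin_dim_subset[OF f sub(2)] subspace_eigsum])
    have "eigsum (insert \<nu> I) = span (A \<union> B)"
      unfolding eigsum_insert span_Un A(4) B(4) ..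
    then have "dim (eigsum (insert \<nu> I)) \<le> card (A \<union> B)" using A(1) B(1) by (intro dim_le_card) auto
    also have "\<dots> \<le> card A + card B" by (rule card_Un_le)
    finally show ?thesis using A(5) B(5) by simp
  qed
  ultimately show ?case using insert by simp
qed

lemma dim_eigspace_pos:
  assumes "\<nu> \<in> form_spectrum c m"
  shows "1 \<le> dim (eigspace \<nu>)"
proof -
  obtain u where u: "u \<in> eigspace \<nu>" "u \<noteq> 0" using assms spectrum_iff by blast
  have f: "fin_dim (eigspace \<nu>)"
    using fin_dim_subset[OF fin_dim_eigsum[of "{\<nu>}" \<nu>] eigspace_subset_eigsum] by simp
  have "independent {u}" using u(2) by simp
  then show ?thesis using independent_card_le_dim_fin(2)[OF f, of "{u}"] u(1) by simp
qed

lemma finite_low_spectrum: "finite {\<nu> \<in> form_spectrum c m. \<nu> \<le> \<gamma>}"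
proof (rule ccontr)
  let ?J = "{\<nu> \<in> form_spectrum c m. \<nu> \<le> \<gamma>}"
  assume "infinite ?J"
  then obtain I where I: "finite I" "card I = Suc (dim (eigsum {..\<gamma>}))" "I \<subseteq> ?J"
    using infinite_arbitrarily_large by blast
  have I': "I \<subseteq> {..\<gamma>}" using I(3) by auto
  have "card I = (\<Sum>\<nu>\<in>I. 1)" by simp
  also have "\<dots> \<le> (\<Sum>\<nu>\<in>I. dim (eigspace \<nu>))"
    using I(3) dim_eigspace_pos by (intro sum_mono) auto
  also have "\<dots> = dim (eigsum I)" using dim_eigsum[OF I(1) I'] by simp
  also have "\<dots> \<le> dim (eigsum {..\<gamma>})"
    by (rule dim_mono_fin[OF fin_dim_eigsum_atMost eigsum_mono[OF I']])
  finally show False using I(2) by simp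
qed

lemma eigsum_restrict_spectrum: "eigsum {\<nu> \<in> form_spectrum c m. \<nu> \<le> \<gamma>} = eigsum {..\<gamma>}"
proof
  show "eigsum {..\<gamma>} \<subseteq> eigsum {\<nu> \<in> form_spectrum c m. \<nu> \<le> \<gamma>}"
    unfolding eigsum_def[of "{..\<gamma>}"]
  proof (rule span_minimal[OF _ subspace_eigsum], rule subsetI)
    fix x assume "x \<in> (\<Union>\<nu>\<in>{..\<gamma>}. eigspace \<nu>)"
    then obtain \<nu> where \<nu>: "\<nu> \<le> \<gamma>" "x \<in> eigspace \<nu>" by auto
    show "x \<in> eigsum {\<nu> \<in> form_spectrum c m. \<nu> \<le> \<gamma>}"
    proof (cases "x = 0")
      case True
      then show ?thesis using subspace_0[OF subspace_eigsum] by simp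
    next
      case False
      then have "\<nu> \<in> {\<nu> \<in> form_spectrum c m. \<nu> \<le> \<gamma>}" using \<nu> spectrum_iff by blast
      then show ?thesis using \<nu>(2) by (rule subsetD[OF eigspace_subset_eigsum])
    qed
  qed
  show "eigsum {\<nu> \<in> form_spectrum c m. \<nu> \<le> \<gamma>} \<subseteq> eigsum {..\<gamma>}"
    by (rule eigsum_mono) auto
qed

lemma sum_dim_eigspaces: "(\<Sum>\<nu>\<in>{\<nu> \<in> form_spectrum c m. \<nu> \<le> \<gamma>}. dim (eigspace \<nu>)) = dim (eigsum {..\<gamma>})"
proof -
  have "{\<nu> \<in> form_spectrum c m. \<nu> \<le> \<gamma>} \<subseteq> {..\<gamma>}" by auto
  from dim_eigsum[OF finite_low_spectrum this] show ?thesis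
    unfolding eigsum_restrict_spectrum by (rule sym)
qed

text \<open>
If \<open>Z\<close> had larger dimension than the span \<open>E\<close> of the low eigenvectors, some nonzero vector of \<open>Z\<close>
would be \<open>m\<close>-orthogonal to \<open>E\<close>. Minimizing the Rayleigh quotient on the \<open>m\<close>-orthogonal space of \<open>E\<close>
then yields an eigenvector with eigenvalue at most \<open>\<gamma>\<close> that is not in \<open>E\<close>.
\<close>

lemma dim_nonpos_le_dim_eigsum:
  assumes Z: "subspace Z" "\<And>x. x \<in> Z \<Longrightarrow> c x x \<le> \<gamma> * m x x"
  shows "dim Z \<le> dim (eigsum {..\<gamma>})"
proof (rule ccontr)
  let ?E = "eigsum {..\<gamma>}"
  assume "\<not> ?thesis"
  then have lt: "dim ?E < dim Z" by simp
  have fE: "fin_dim ?E" by (rule fin_dim_eigsum_atMost)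
  have "dim Z \<le> dim {x \<in> Z. \<forall>e\<in>?E. m e x = 0} + dim ?E"
    by (rule dim_le_dim_perp[OF m nonpos_imp_fin_dim[OF Z] Z(1) fE subspace_eigsum])
  then have "0 < dim {x \<in> Z. \<forall>e\<in>?E. m e x = 0}" using lt by simp
  then obtain u0 where u0: "u0 \<in> Z" "\<forall>e\<in>?E. m e u0 = 0" "u0 \<noteq> 0"
    using exists_nonzero_of_dim_pos by blast
  define H where "H = {x. \<forall>e\<in>?E. m e x = 0}"
  have H: "subspace H" using m by (auto simp: H_def subspace_def sb_simps)
  have "H = (\<Inter>e\<in>?E. {x. m e x = 0})" by (auto simp: H_def)
  moreover have "closed {x. m e x = 0}" for e
  proof -
    have cm: "continuous_on UNIV (m e)"
      using bounded_bilinear.bounded_linear_right[OF bounded_m] by (simp add: linear_continuous_on)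
    show ?thesis using closed_Collect_eq[OF cm continuous_on_const] .
  qed
  ultimately have clH: "closed H" by auto
  obtain \<nu> z where \<nu>: "\<nu> \<le> \<gamma>" and z: "z \<in> H" "z \<noteq> 0" "\<forall>v\<in>H. c z v = \<nu> * m z v"
    using exists_lowest_critical_point[OF H clH _ u0(3) Z(2)[OF u0(1)]] u0(2) by (auto simp: H_def)
  have mz: "m z e = 0" if "e \<in> ?E" for e
    using z(1) that sb_sym[OF m, of z e] by (simp add: H_def)
  have "?E \<subseteq> {v. c z v = 0}"
    unfolding eigsum_def
  proof (rule span_minimal)
    show "(\<Union>\<nu>\<in>{..\<gamma>}. eigspace \<nu>) \<subseteq> {v. c z v = 0}"
    proof
      fix e assume "e \<in> (\<Union>\<nu>\<in>{..\<gamma>}. eigspace \<nu>)"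
      then obtain \<mu> where e: "\<mu> \<le> \<gamma>" "e \<in> eigspace \<mu>" by auto
      then have "e \<in> ?E" using eigspace_subset_eigsum[of \<mu> "{..\<gamma>}"] by auto
      then have "m e z = 0" using z(1) by (auto simp: H_def)
      then show "e \<in> {v. c z v = 0}" using eigspace_eq[OF e(2), of z] sb_sym[OF c, of z e] by simp
    qed
    show "subspace {v. c z v = 0}"
      using subspace_kernel_in[OF subspace_UNIV sb_linear[OF c, of z]] by simp
  qed
  then have cz: "c z e = 0" if "e \<in> ?E" for e using that by blast
  have "c z v = \<nu> * m z v" for v
  proof -
    obtain w where w: "w \<in> ?E" "\<forall>x\<in>?E. m x (v - w) = 0"
      by (rule nondeg_projection[OF m fE subspace_eigsum posdef_imp_nondeg[OF posdef_m], of v])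
    then have "v - w \<in> H" by (simp add: H_def)
    then have "c z (v - w) = \<nu> * m z (v - w)" using z(3) by blast
    then show ?thesis
      using cz[OF w(1)] mz[OF w(1)] sb_diff_right[OF c, of z v w] sb_diff_right[OF m, of z v w] by simp
  qed
  then have "z \<in> eigspace \<nu>" by (simp add: form_eigenspace_def)
  then have "z \<in> ?E" using eigspace_subset_eigsum[of \<nu> "{..\<gamma>}"] \<nu> by auto
  then have "m z z = 0" using mz by blast
  then show False using m_pos[OF z(2)] by simp
qed

text \<open>
The min-max principle in counting form. The subspace \<open>Z0\<close> guarantees that there are at least \<open>i\<close>
eigenvalues at all: on it \<open>c\<close> is bounded by a multiple of \<open>m\<close>, so the counting function reaches
\<open>i\<close> at that multiple. As only finitely many eigenvalues lie below it, the least element asked for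
in the definition exists.
\<close>

lemma nth_eigenvalue_le_iff:
  fixes Z0 :: "'a set"
  assumes i: "1 \<le> i" and V: "fin_dim Z0" "subspace Z0" "i \<le> dim Z0"
  shows "nth_eigenvalue c m i \<le> \<gamma> \<longleftrightarrow>
    (\<exists>Z. subspace Z \<and> fin_dim Z \<and> i \<le> dim Z \<and> (\<forall>z\<in>Z. c z z \<le> \<gamma> * m z z))"
proof -
  define P where "P \<mu> \<longleftrightarrow> \<mu> \<in> form_spectrum c m \<and>
    i \<le> (\<Sum>\<nu>\<in>{\<nu> \<in> form_spectrum c m. \<nu> \<le> \<mu>}. dim (eigspace \<nu>))" for \<mu>
  have nth: "nth_eigenvalue c m i = (LEAST \<mu>. P \<mu>)"
    by (simp add: nth_eigenvalue_def P_def)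
  have ex: "\<exists>\<mu>\<le>\<gamma>. P \<mu>" if Z: "subspace Z" "i \<le> dim Z" "\<forall>z\<in>Z. c z z \<le> \<gamma> * m z z" for Z \<gamma>
  proof -
    let ?J = "{\<nu> \<in> form_spectrum c m. \<nu> \<le> \<gamma>}"
    have le: "i \<le> (\<Sum>\<nu>\<in>?J. dim (eigspace \<nu>))"
      using dim_nonpos_le_dim_eigsum[OF Z(1), of \<gamma>] Z(2,3) sum_dim_eigspaces[of \<gamma>] by simp
    have ne: "?J \<noteq> {}"
    proof
      assume "?J = {}"
      then have "(\<Sum>\<nu>\<in>?J. dim (eigspace \<nu>)) = 0" by (simp only: sum.empty)
      then show False using le i by linarith
    qed
    define \<mu> where "\<mu> = Max ?J"
    have \<mu>: "\<mu> \<in> ?J" unfolding \<mu>_def by (rule Max_in[OF finite_low_spectrum ne])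
    have "{\<nu> \<in> form_spectrum c m. \<nu> \<le> \<mu>} = ?J"
    proof
      show "?J \<subseteq> {\<nu> \<in> form_spectrum c m. \<nu> \<le> \<mu>}"
        unfolding \<mu>_def using Max_ge[OF finite_low_spectrum] by blast
      show "{\<nu> \<in> form_spectrum c m. \<nu> \<le> \<mu>} \<subseteq> ?J" using \<mu> by auto
    qed
    then have "P \<mu>" using le \<mu> unfolding P_def by simp
    then show ?thesis using \<mu> by blast
  qed
  obtain C where "\<forall>x\<in>Z0. \<bar>c x x\<bar> \<le> C * m x x"
    using form_bounded_by_posdef[OF m c V(1,2) posdef_m] by blast
  then have "\<forall>x\<in>Z0. c x x \<le> C * m x x" by (meson abs_le_D1)
  then obtain \<mu>0 where \<mu>0: "P \<mu>0" using ex[OF V(2,3)] by blast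
  have fin: "finite {\<mu>. P \<mu> \<and> \<mu> \<le> \<mu>0}"
    by (rule finite_subset[OF _ finite_low_spectrum[of \<mu>0]]) (auto simp: P_def)
  define \<mu>1 where "\<mu>1 = Min {\<mu>. P \<mu> \<and> \<mu> \<le> \<mu>0}"
  have \<mu>1: "P \<mu>1 \<and> \<mu>1 \<le> \<mu>0"
    using Min_in[OF fin] \<mu>0 unfolding \<mu>1_def by blast
  have least: "\<mu>1 \<le> \<mu>" if "P \<mu>" for \<mu>
  proof (cases "\<mu> \<le> \<mu>0")
    case True
    then show ?thesis unfolding \<mu>1_def using that by (intro Min_le[OF fin]) auto
  next
    case False
    then show ?thesis using \<mu>1 by linarith
  qed
  have eq: "nth_eigenvalue c m i = \<mu>1"
    unfolding nth using \<mu>1 least by (intro Least_equality) auto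
  show ?thesis
  proof
    assume "nth_eigenvalue c m i \<le> \<gamma>"
    then have \<mu>1\<gamma>: "\<mu>1 \<le> \<gamma>" using eq by simp
    have "i \<le> dim (eigsum {..\<mu>1})" using \<mu>1 sum_dim_eigspaces[of \<mu>1] by (simp add: P_def)
    also have "\<dots> \<le> dim (eigsum {..\<gamma>})"
      using \<mu>1\<gamma> by (intro dim_mono_fin fin_dim_eigsum_atMost eigsum_mono) auto
    finally show "\<exists>Z. subspace Z \<and> fin_dim Z \<and> i \<le> dim Z \<and> (\<forall>z\<in>Z. c z z \<le> \<gamma> * m z z)"
      using eigsum_nonpos subspace_eigsum fin_dim_eigsum_atMost by blast
  next
    assume "\<exists>Z. subspace Z \<and> fin_dim Z \<and> i \<le> dim Z \<and> (\<forall>z\<in>Z. c z z \<le> \<gamma> * m z z)"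
    then obtain \<mu> where "\<mu> \<le> \<gamma>" "P \<mu>" using ex by blast
    then show "nth_eigenvalue c m i \<le> \<gamma>" using least eq by fastforce
  qed
qed

end

section \<open>Counting components of superlevel sets\<close>

lemma component_above: "C \<in> superlevel_components f y \<Longrightarrow> x \<in> C \<Longrightarrow> y < f x"
  by (auto simp: superlevel_components_def)

lemma component_interval:
  assumes "C \<in> superlevel_components f y" "x \<in> C" "z \<in> C" "x \<le> w" "w \<le> z"
  shows "w \<in> C"
  using assms by (auto simp: superlevel_components_def)

lemma component_nonempty: "C \<in> superlevel_components f y \<Longrightarrow> \<exists>x. x \<in> C"
  by (auto simp: superlevel_components_def dest: dense intro: lt_ex gt_ex)

text \<open>
If \<open>C'\<close> reached beyond \<open>C\<close>, it would contain an end of \<open>C\<close>, where \<open>f = y\<close>.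
\<close>

lemma component_maximal:
  assumes C: "C \<in> superlevel_components f y" and C': "C' \<in> superlevel_components f y"
    and x: "x \<in> C" "x \<in> C'"
  shows "C' \<subseteq> C"
proof
  fix z assume z: "z \<in> C'"
  have no: "f w \<noteq> y" if "min x z \<le> w" "w \<le> max x z" for w
  proof -
    have "w \<in> C'"
      using component_interval[OF C' x(2) z] component_interval[OF C' z x(2)] that
      by (cases "x \<le> z") (auto simp: min_def max_def)
    then show ?thesis using component_above[OF C'] by force
  qed
  show "z \<in> C"
  proof (rule ccontr)
    assume nz: "z \<notin> C"
    have "\<exists>w. min x z \<le> w \<and> w \<le> max x z \<and> f w = y"
      using C x(1) nz unfolding superlevel_components_def
      by (auto simp: min_def max_def not_less) (metis less_imp_le linorder_not_less order_trans)+
    then show False using no by blast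
  qed
qed

lemma component_eq:
  assumes "C \<in> superlevel_components f y" "C' \<in> superlevel_components f y" "x \<in> C" "x \<in> C'"
  shows "C = C'"
  using component_maximal assms by (metis subset_antisym)

text \<open>
The end \<open>s\<close> of \<open>C\<close> that faces \<open>l\<close>, with \<open>\<sigma>\<close> the direction from \<open>l\<close> through \<open>s\<close> into \<open>C\<close>. The end may
be \<open>l\<close> itself.
\<close>

lemma component_near_end:
  assumes C: "C \<in> superlevel_components f y" and l: "l \<notin> C"
  shows "\<exists>s \<sigma> \<delta>. (\<sigma> = 1 \<or> \<sigma> = - 1) \<and> 0 \<le> \<sigma> * (s - l) \<and> f s = y \<and> 0 < \<delta> \<and>
    (\<forall>\<rho>. 0 < \<rho> \<and> \<rho> < \<delta> \<longrightarrow> s + \<sigma> * \<rho> \<in> C)"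
proof -
  consider (fin) s t where "C = {s<..<t}" "s < t" "f s = y" "f t = y"
    | (right) s where "C = {s<..}" "f s = y" | (left) t where "C = {..<t}" "f t = y"
    using C unfolding superlevel_components_def by blast
  then show ?thesis
  proof cases
    case fin
    then consider "l \<le> s" | "t \<le> l" using l by force
    then show ?thesis
    proof cases
      case 1
      then show ?thesis using fin by (intro exI[of _ s] exI[of _ 1] exI[of _ "t - s"]) auto
    next
      case 2
      then show ?thesis using fin by (intro exI[of _ t] exI[of _ "- 1"] exI[of _ "t - s"]) auto
    qed
  next
    case right
    then show ?thesis using l by (intro exI[of _ s] exI[of _ 1] exI[of _ 1]) auto
  next
    case left
    then show ?thesis using l by (intro exI[of _ t] exI[of _ "- 1"] exI[of _ 1]) auto
  qed
qed

lemma finite_pos_lower_bound: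
  assumes "finite X" "\<And>x. x \<in> X \<Longrightarrow> 0 < (x::real)"
  shows "\<exists>e>0. \<forall>x\<in>X. e < x"
  using assms
proof (induction X rule: finite_induct)
  case empty
  then show ?case by (auto intro: exI[of _ 1])
next
  case (insert x X)
  then obtain e where e: "0 < e" "\<forall>x\<in>X. e < x" by auto
  have "0 < x" using insert(4) by simp
  then show ?case using e by (intro exI[of _ "min e (x / 2)"]) auto
qed

text \<open>
Fix a point \<open>l\<close> of one of the given components. Those containing \<open>l\<close> belong to different levels
\<open>i\<close>, all above the index at \<open>l\<close>. Each of the others is entered, coming from \<open>l\<close>, at its near end \<open>s\<close>,
where the form has a nonpositive subspace of dimension \<open>i\<close> that is lost immediately after; so the
index drops past \<open>i\<close> between \<open>s\<close> and \<open>s + \<sigma> * \<epsilon>\<close>, and \<open>sum_index_drops_le\<close> bounds the number of these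
components by the index at \<open>l\<close>.

To make this finite dimensional, everything is restricted to a subspace \<open>F\<close> that contains the
nonpositive subspaces at the near ends: restriction can only lower the index elsewhere, which is
harmless. To make it nondegenerate, \<open>A\<close> is replaced by \<open>A - \<eta> m\<close>, which turns nonpositive subspaces
into negative definite ones and, for small \<open>\<eta>\<close>, keeps the positive definite complements.
\<close>

lemma card_components_le:
  fixes A b m :: "'a::real_vector \<Rightarrow> 'a \<Rightarrow> real" and \<mu> :: "nat \<Rightarrow> real \<Rightarrow> real"
  assumes A: "symmetric_bilinear A" and b: "symmetric_bilinear b" and m: "symmetric_bilinear m"
    and m_pos: "\<And>u. u \<noteq> 0 \<Longrightarrow> 0 < m u u"
    and \<mu>: "\<And>i t. i \<in> {1..n} \<Longrightarrow> \<mu> i t \<le> y \<longleftrightarrow>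
      (\<exists>Z. subspace Z \<and> fin_dim Z \<and> i \<le> dim Z \<and> nonpos_on (pencil A b t) Z)"
    and D: "finite D" "D \<subseteq> (SIGMA i:{1..n}. superlevel_components (\<mu> i) y)"
  shows "card D \<le> n"
proof (cases "D = {}")
  case True
  then show ?thesis by simp
next
  case False
  then obtain i0 C0 where i0: "(i0, C0) \<in> D" by auto
  then have i0n: "i0 \<in> {1..n}" and C0: "C0 \<in> superlevel_components (\<mu> i0) y" using D(2) by auto
  obtain l where l: "l \<in> C0" using component_nonempty[OF C0] by blast
  have comp: "fst p \<in> {1..n}" "snd p \<in> superlevel_components (\<mu> (fst p)) y" if "p \<in> D" for p
    using that D(2) by auto
  define Out where "Out = {p \<in> D. l \<notin> snd p}"
  define In where "In = {p \<in> D. l \<in> snd p}"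
  have OutD: "Out \<subseteq> D" by (auto simp: Out_def)
  have finOut: "finite Out" using D(1) OutD finite_subset by blast
  have "\<forall>p\<in>Out. \<exists>s \<sigma> \<delta>. (\<sigma> = 1 \<or> \<sigma> = - 1) \<and> 0 \<le> \<sigma> * (s - l) \<and> \<mu> (fst p) s = y \<and> 0 < \<delta> \<and>
    (\<forall>\<rho>. 0 < \<rho> \<and> \<rho> < \<delta> \<longrightarrow> s + \<sigma> * \<rho> \<in> snd p)"
  proof
    fix p assume p: "p \<in> Out"
    then have "p \<in> D" "l \<notin> snd p" by (auto simp: Out_def)
    then show "\<exists>s \<sigma> \<delta>. (\<sigma> = 1 \<or> \<sigma> = - 1) \<and> 0 \<le> \<sigma> * (s - l) \<and> \<mu> (fst p) s = y \<and> 0 < \<delta> \<and>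
      (\<forall>\<rho>. 0 < \<rho> \<and> \<rho> < \<delta> \<longrightarrow> s + \<sigma> * \<rho> \<in> snd p)"
      using component_near_end[OF comp(2)] by blast
  qed
  then obtain s \<sigma> \<delta> where s\<sigma>\<delta>: "\<forall>p\<in>Out. (\<sigma> p = 1 \<or> \<sigma> p = - 1) \<and> 0 \<le> \<sigma> p * (s p - l) \<and>
    \<mu> (fst p) (s p) = y \<and> 0 < \<delta> p \<and> (\<forall>\<rho>. 0 < \<rho> \<and> \<rho> < \<delta> p \<longrightarrow> s p + \<sigma> p * \<rho> \<in> snd p)"
    unfolding bchoice_iff by blast
  have \<sigma>: "\<sigma> p = 1 \<or> \<sigma> p = - 1" and side: "0 \<le> \<sigma> p * (s p - l)" and \<mu>s: "\<mu> (fst p) (s p) = y"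
    and \<delta>: "0 < \<delta> p" and inC: "\<And>\<rho>. 0 < \<rho> \<Longrightarrow> \<rho> < \<delta> p \<Longrightarrow> s p + \<sigma> p * \<rho> \<in> snd p"
    if "p \<in> Out" for p using s\<sigma>\<delta> that by blast+
  \<comment> \<open>A step length \<open>\<epsilon>\<close> that stays inside every component and keeps different near ends apart.\<close>
  define G where "G = \<delta> ` Out \<union> (\<lambda>(p, p'). \<bar>s p - s p'\<bar>) ` {(p, p') \<in> Out \<times> Out. s p \<noteq> s p'}"
  have finG: "finite G" unfolding G_def using finOut
    by (intro finite_UnI finite_imageI finite_subset[OF _ finite_cartesian_product[OF finOut finOut]]) auto
  have G0: "0 < x" if "x \<in> G" for x using that \<delta> by (auto simp: G_def)
  have "\<exists>e>0. \<forall>x\<in>G. e < x" by (rule finite_pos_lower_bound[OF finG G0])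
  then obtain \<epsilon> where \<epsilon>: "0 < \<epsilon>" "\<forall>x\<in>G. \<epsilon> < x" by blast
  have \<epsilon>\<delta>: "\<epsilon> < \<delta> p" if "p \<in> Out" for p using \<epsilon>(2) that by (auto simp: G_def)
  have \<epsilon>s: "\<epsilon> < \<bar>s p - s p'\<bar>" if "p \<in> Out" "p' \<in> Out" "s p \<noteq> s p'" for p p'
  proof -
    have "(p, p') \<in> {(p, p') \<in> Out \<times> Out. s p \<noteq> s p'}" using that by simp
    then have "\<bar>s p - s p'\<bar> \<in> G" unfolding G_def by (intro UnI2 image_eqI[of _ _ "(p, p')"]) auto
    then show ?thesis using \<epsilon>(2) by blast
  qed
  define step where "step p = (s p, s p + \<sigma> p * \<epsilon>)" for p
  define T where "T = step ` Out"
  have finT: "finite T" using finOut by (simp add: T_def)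
  have inC': "snd (step p) \<in> snd p" if "p \<in> Out" for p
    using inC[OF that \<epsilon>(1) \<epsilon>\<delta>[OF that]] by (simp add: step_def)
  have outw: "outward l q" if q: "q \<in> T" for q
  proof -
    obtain p where p: "p \<in> Out" "q = step p" using q by (auto simp: T_def)
    show ?thesis using \<sigma>[OF p(1)] side[OF p(1)] \<epsilon>(1) by (auto simp: p(2) step_def outward_def)
  qed
  have disj: "disjoint_steps T"
    unfolding disjoint_steps_def
  proof (intro ballI impI, rule ccontr)
    fix q q' assume q: "q \<in> T" "q' \<in> T" and ne: "q \<noteq> q'"
      and meet: "open_segment (fst q) (snd q) \<inter> open_segment (fst q') (snd q') \<noteq> {}"
    obtain p where p: "p \<in> Out" "q = step p" using q(1) unfolding T_def by blast
    obtain p' where p': "p' \<in> Out" "q' = step p'" using q(2) unfolding T_def by blast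
    obtain x where x: "x \<in> open_segment (s p) (s p + \<sigma> p * \<epsilon>)"
        "x \<in> open_segment (s p') (s p' + \<sigma> p' * \<epsilon>)"
      using meet by (auto simp: p(2) p'(2) step_def)
    have "\<sigma> p = \<sigma> p' \<and> \<bar>s p - s p'\<bar> < \<epsilon>"
      using \<sigma>[OF p(1)] \<sigma>[OF p'(1)] side[OF p(1)] side[OF p'(1)] x \<epsilon>(1)
      by (auto simp: open_segment_eq_real_ivl split: if_splits)
    moreover then have "s p = s p'" using \<epsilon>s[OF p(1) p'(1)] by force
    ultimately show False using ne p(2) p'(2) by (simp add: step_def)
  qed
  have "\<forall>p\<in>Out. \<exists>Z. subspace Z \<and> fin_dim Z \<and> fst p \<le> dim Z \<and> nonpos_on (pencil A b (s p)) Z"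
    using \<mu> comp(1) \<mu>s OutD by (metis order_refl subsetD)
  then obtain Z where Z: "\<forall>p\<in>Out. subspace (Z p) \<and> fin_dim (Z p) \<and> fst p \<le> dim (Z p) \<and>
      nonpos_on (pencil A b (s p)) (Z p)"
    unfolding bchoice_iff by blast
  have "\<forall>p\<in>Out. \<exists>B. finite B \<and> Z p \<subseteq> span B" using Z by (simp add: fin_dim_def)
  then obtain B where B: "\<forall>p\<in>Out. finite (B p) \<and> Z p \<subseteq> span (B p)"
    unfolding bchoice_iff by blast
  define F where "F = span (\<Union>p\<in>Out. B p)"
  have F: "fin_dim F" "subspace F"
    unfolding F_def using finOut B by (auto intro: fin_dim_span)
  have ZF: "Z p \<subseteq> F" if "p \<in> Out" for p
    using B that span_mono[of "B p" "\<Union>p\<in>Out. B p"] unfolding F_def by blast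
  define X where "X = insert l (fst ` T \<union> snd ` T)"
  have finX: "finite X" using finT by (simp add: X_def)
  have "\<forall>x\<in>X. \<exists>N P \<tau>. subspace N \<and> subspace P \<and> N \<subseteq> F \<and> P \<subseteq> F \<and>
    nonpos_on (pencil A b x) N \<and> dim F \<le> dim N + dim P \<and> 0 < \<tau> \<and>
    (\<forall>t. \<bar>t\<bar> < \<tau> \<longrightarrow> posdef_on (pencil (pencil A b x) m t) P)"
  proof
    fix x
    note q = sb_diff_scale[OF A b, of x]
    obtain N P where NP: "subspace N" "subspace P" "N \<subseteq> F" "P \<subseteq> F" "nonpos_on (pencil A b x) N"
      "posdef_on (pencil A b x) P" "dim F \<le> dim N + dim P"
      by (rule exists_nonpos_posdef_split[OF q F])
    obtain \<tau> where \<tau>: "0 < \<tau>" "\<forall>t. \<bar>t\<bar> < \<tau> \<longrightarrow> posdef_on (pencil (pencil A b x) m t) P"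
      by (rule posdef_on_open[OF q m fin_dim_subset[OF F(1) NP(4)] NP(2,6)])
    show "\<exists>N P \<tau>. subspace N \<and> subspace P \<and> N \<subseteq> F \<and> P \<subseteq> F \<and>
      nonpos_on (pencil A b x) N \<and> dim F \<le> dim N + dim P \<and> 0 < \<tau> \<and>
      (\<forall>t. \<bar>t\<bar> < \<tau> \<longrightarrow> posdef_on (pencil (pencil A b x) m t) P)"
      by (intro exI[of _ N] exI[of _ P] exI[of _ \<tau>] conjI NP(1-5,7) \<tau>)
  qed
  then obtain N P \<tau> where NP: "\<forall>x\<in>X. subspace (N x) \<and> subspace (P x) \<and> N x \<subseteq> F \<and> P x \<subseteq> F \<and>
    nonpos_on (pencil A b x) (N x) \<and> dim F \<le> dim (N x) + dim (P x) \<and> 0 < \<tau> x \<and>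
    (\<forall>t. \<bar>t\<bar> < \<tau> x \<longrightarrow> posdef_on (pencil (pencil A b x) m t) (P x))"
    unfolding bchoice_iff by blast
  have "\<exists>\<eta>>0. \<forall>z\<in>\<tau> ` X. \<eta> < z"
    using finX NP by (intro finite_pos_lower_bound) auto
  then obtain \<eta> where \<eta>: "0 < \<eta>" "\<And>x. x \<in> X \<Longrightarrow> \<eta> < \<tau> x" by auto
  \<comment> \<open>For \<open>A = a - y m\<close> this raises the level from \<open>y\<close> to \<open>y + \<eta>\<close>.\<close>
  define A' where "A' = pencil A m \<eta>"
  have A': "symmetric_bilinear A'" unfolding A'_def by (rule sb_diff_scale[OF A m])
  have Q': "pencil A' b x = pencil (pencil A b x) m \<eta>" for x
    by (auto simp: A'_def fun_eq_iff)
  have negdef: "negdef_on (pencil A' b x) W" if "nonpos_on (pencil A b x) W" for x W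
    unfolding negdef_on_def Q'
  proof (intro ballI impI)
    fix z assume z: "z \<in> W" "z \<noteq> 0"
    have "0 < \<eta> * m z z" using m_pos[OF z(2)] \<eta>(1) by simp
    then show "pencil A b x z z - \<eta> * m z z < 0" using that z(1) unfolding nonpos_on_def by force
  qed
  have split: "splits_on (pencil A' b x) F (N x) (P x)" if x: "x \<in> X" for x
  proof -
    have "posdef_on (pencil A' b x) (P x)" unfolding Q' using NP \<eta> x by simp
    then show ?thesis using NP x negdef[of x "N x"] unfolding splits_on_def by blast
  qed
  define g where "g x = negative_index (pencil A' b x) F" for x
  have gN: "g x = dim (N x)" if "x \<in> X" for x
    unfolding g_def by (rule negative_index_eqI[OF F(1) split[OF that]])
  have nd: "nondeg_on (pencil A' b x) F" if "x \<in> X" for x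
    by (rule splits_imp_nondeg[OF sb_diff_scale[OF A' b] F split[OF that]])
  have g_less: "g x < i" if x: "x \<in> X" and i: "i \<in> {1..n}" and above: "y < \<mu> i x" for x i
  proof (rule ccontr)
    assume "\<not> ?thesis"
    then have "i \<le> dim (N x)" using gN[OF x] by simp
    moreover have "fin_dim (N x)" using NP x fin_dim_subset[OF F(1)] by blast
    ultimately have "\<mu> i x \<le> y" using \<mu>[OF i] NP x by blast
    then show False using above by simp
  qed
  have g_ge: "fst p \<le> g (s p)" if p: "p \<in> Out" for p
  proof -
    have "dim (Z p) \<le> g (s p)"
      unfolding g_def using Z p ZF[OF p] by (intro negdef_le_negative_index[OF F(1)] negdef) auto
    then show ?thesis using Z p by force
  qed
  have lX: "l \<in> X" and TX: "\<And>q. q \<in> T \<Longrightarrow> fst q \<in> X \<and> snd q \<in> X" by (auto simp: X_def)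
  have drops: "(\<Sum>q\<in>T. g (fst q) - g (snd q)) \<le> g l"
    unfolding g_def using nd lX TX by (intro sum_index_drops_le[OF A' b finT outw disj F]) auto
  have "card Out \<le> (\<Sum>q\<in>T. g (fst q) - g (snd q))"
  proof -
    let ?R = "SIGMA q:T. {g (snd q)<..g (fst q)}"
    have "inj_on (\<lambda>p. (step p, fst p)) Out"
    proof (rule inj_onI)
      fix p p' assume p: "p \<in> Out" "p' \<in> Out" "(step p, fst p) = (step p', fst p')"
      have "snd (step p) \<in> snd p" "snd (step p) \<in> snd p'"
        using inC'[OF p(1)] inC'[OF p(2)] p(3) by simp_all
      moreover have "snd p \<in> superlevel_components (\<mu> (fst p)) y"
        "snd p' \<in> superlevel_components (\<mu> (fst p)) y"
        using comp(2)[of p] comp(2)[of p'] p OutD by auto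
      ultimately have "snd p = snd p'" using component_eq by blast
      then show "p = p'" using p(3) by (simp add: prod_eq_iff)
    qed
    moreover have "(\<lambda>p. (step p, fst p)) ` Out \<subseteq> ?R"
    proof (rule image_subsetI)
      fix p assume p: "p \<in> Out"
      then have T: "step p \<in> T" and D': "p \<in> D" using OutD by (auto simp: T_def)
      have "g (snd (step p)) < fst p"
        using TX[OF T] comp(1)[OF D'] component_above[OF comp(2)[OF D'] inC'[OF p]] by (intro g_less) auto
      moreover have "fst p \<le> g (fst (step p))" using g_ge[OF p] by (simp add: step_def)
      ultimately show "(step p, fst p) \<in> ?R" using T by simp
    qed
    moreover have "finite ?R" using finT by auto
    ultimately have "card Out \<le> card ?R" by (rule card_inj_on_le)
    also have "\<dots> = (\<Sum>q\<in>T. g (fst q) - g (snd q))" using finT by simp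
    finally show ?thesis .
  qed
  then have cOut: "card Out \<le> g l" using drops by linarith
  have "inj_on fst In"
  proof (rule inj_onI)
    fix p p' assume p: "p \<in> In" "p' \<in> In" "fst p = fst p'"
    then have "p \<in> D" "p' \<in> D" "l \<in> snd p" "l \<in> snd p'" by (auto simp: In_def)
    then have "snd p = snd p'" using component_eq[of "snd p" "\<mu> (fst p)" y "snd p'" l] comp(2) p(3) by metis
    then show "p = p'" using p(3) by (simp add: prod_eq_iff)
  qed
  moreover have "fst ` In \<subseteq> {g l<..n}"
  proof (rule image_subsetI)
    fix p assume "p \<in> In"
    then have p: "p \<in> D" "l \<in> snd p" by (auto simp: In_def)
    show "fst p \<in> {g l<..n}"
      using g_less[OF lX comp(1)[OF p(1)] component_above[OF comp(2)[OF p(1)] p(2)]] comp(1)[OF p(1)] by simp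
  qed
  ultimately have "card In \<le> card {g l<..n}" by (intro card_inj_on_le[of fst]) auto
  then have cIn: "card In \<le> n - g l" by simp
  have gl: "g l < i0" by (rule g_less[OF lX i0n component_above[OF C0 l]])
  have "card D \<le> card Out + card In"
  proof -
    have "D = Out \<union> In" by (auto simp: Out_def In_def)
    then show ?thesis by (metis card_Un_le)
  qed
  then show ?thesis using cOut cIn gl i0n by simp
qed

lemma exists_subspace_of_dim:
  assumes "fin_dim (UNIV :: 'a::real_vector set) \<Longrightarrow> n \<le> dim (UNIV :: 'a::real_vector set)"
  obtains Z :: "'a::real_vector set" where "fin_dim Z" "subspace Z" "n \<le> dim Z"
proof (cases "fin_dim (UNIV :: 'a set)")
  case True
  then show ?thesis using that[OF True subspace_UNIV] assms by blast
next
  case False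
  have "\<exists>Z :: 'a set. fin_dim Z \<and> subspace Z \<and> k \<le> dim Z" for k
  proof (induction k)
    case 0
    have "fin_dim (span {} :: 'a set)" by (rule fin_dim_span) simp
    then show ?case using subspace_span by blast
  next
    case (Suc k)
    then obtain Z :: "'a set" where Z: "fin_dim Z" "subspace Z" "k \<le> dim Z" by blast
    then obtain x where "x \<notin> Z" using False by (metis UNIV_eq_I)
    then show ?case
      using dim_span_insert_fin[OF Z(1,2)] Z(3) fin_dim_span_insert[OF Z(1), of x] subspace_span
      by (metis Suc_le_mono)
  qed
  then show ?thesis using that by blast
qed

theorem theorem10p6:
  fixes a b m :: "'a::{real_inner, banach, second_countable_topology} \<Rightarrow> 'a \<Rightarrow> real"
    and \<mu>\<^sub>s :: real and n :: nat
  assumes "symmetric_bilinear a" and "symmetric_bilinear b" and "symmetric_bilinear m"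
    and "continuous_coercive a"
    and "weakly_continuous b"
    and "weakly_continuous m" and "\<And>u. u \<noteq> 0 \<Longrightarrow> 0 < m u u"
    and "\<mu>\<^sub>s \<notin> form_spectrum a m"
    and "(\<exists>B :: 'a set. finite B \<and> span B = UNIV) \<Longrightarrow> n \<le> dim (UNIV :: 'a set)"
  shows "(\<Sum>i=1..n. num_superlevel_components (pencil_eigenvalue a b m i) \<mu>\<^sub>s) \<le> enat n"
proof -
  note a = assms(1) and b = assms(2) and m = assms(3)
  have "fin_dim (UNIV :: 'a set) \<Longrightarrow> n \<le> dim (UNIV :: 'a set)"
    using assms(9) by (auto simp: fin_dim_def)
  then obtain Z0 :: "'a set" where Z0: "fin_dim Z0" "subspace Z0" "n \<le> dim Z0"
    by (rule exists_subspace_of_dim)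
  have iff: "pencil_eigenvalue a b m i t \<le> \<mu>\<^sub>s \<longleftrightarrow>
      (\<exists>Z. subspace Z \<and> fin_dim Z \<and> i \<le> dim Z \<and> nonpos_on (pencil (pencil a m \<mu>\<^sub>s) b t) Z)"
    if i: "i \<in> {1..n}" for i t
  proof -
    interpret weakly_perturbed_form a "\<lambda>u v. t * b u v" m
    proof
      show "symmetric_bilinear (\<lambda>u v. t * b u v)"
        by (rule symmetric_bilinearI, rule linearI)
           (simp_all add: sb_simps[OF b] sb_sym[OF b] algebra_simps)
      show "weakly_continuous (\<lambda>u v. t * b u v)"
        using assms(5) unfolding weakly_continuous_def by (intro allI impI tendsto_mult_left) blast
    qed fact+
    have "nth_eigenvalue (pencil a b t) m i \<le> \<mu>\<^sub>s \<longleftrightarrow>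
      (\<exists>Z. subspace Z \<and> fin_dim Z \<and> i \<le> dim Z \<and> (\<forall>z\<in>Z. pencil a b t z z \<le> \<mu>\<^sub>s * m z z))"
      by (rule nth_eigenvalue_le_iff[OF _ Z0(1,2)]) (use i Z0(3) in auto)
    then show ?thesis by (simp add: pencil_eigenvalue_def nonpos_on_def algebra_simps)
  qed
  let ?K = "\<lambda>i. superlevel_components (pencil_eigenvalue a b m i) \<mu>\<^sub>s"
  have bound: "card D \<le> n" if "finite D" "D \<subseteq> (SIGMA i:{1..n}. ?K i)" for D
    by (rule card_components_le[OF sb_diff_scale[OF a m] b m assms(7) iff that])
  have fin: "finite (?K i)" if i: "i \<in> {1..n}" for i
  proof (rule ccontr)
    assume "infinite (?K i)"
    then obtain E where E: "finite E" "card E = Suc n" "E \<subseteq> ?K i"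
      using infinite_arbitrarily_large by blast
    have "card ({i} \<times> E) \<le> n" using E i by (intro bound) auto
    then show False using E by (simp add: card_cartesian_product)
  qed
  have "(\<Sum>i=1..n. num_superlevel_components (pencil_eigenvalue a b m i) \<mu>\<^sub>s) = (\<Sum>i=1..n. enat (card (?K i)))"
    using fin by (intro sum.cong) (auto simp: num_superlevel_components_def)
  also have "\<dots> = enat (\<Sum>i=1..n. card (?K i))" by (simp add: of_nat_eq_enat[symmetric])
  also have "(\<Sum>i=1..n. card (?K i)) = card (SIGMA i:{1..n}. ?K i)"
    using fin by simp
  also have "enat \<dots> \<le> enat n"
  proof -
    have "finite (SIGMA i:{1..n}. ?K i)" by (rule finite_SigmaI) (use fin in auto)
    then show ?thesis using bound[OF _ order_refl] by simp
  qed
  finally show ?thesis .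
qed

end
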